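(* Let $g$ be a metric field on $U$ and let $h$ be a gauge metric field for $g$, i.e. $h$ is a non-singular smooth $(1,1)$-extensor field on $U$ with $g=h^{\dagger}\circ\eta\circ h$, where $\eta$ is a pseudo-orthogonal metric field on $U$ with the same signature as $g$. For any $g$-compatible pair of $a$-directional covariant derivative operators $({}_{g}\mathcal{D}_{a}^{+},{}_{g}\mathcal{D}_{a}^{-})$ there exists a unique $\eta$-compatible pair of $a$-directional covariant derivative operators $({}_{\eta}\mathcal{D}_{a}^{+},{}_{\eta}\mathcal{D}_{a}^{-})$ such that for all $X\in\mathcal{M}(U)$ (and all directions $a$) $$\underline{h}({}_{g}\mathcal{D}_{a}^{+}X)={}_{\eta}\mathcal{D}_{a}^{+}\underline{h}(X),\qquad \underline{h}^{*}({}_{g}\mathcal{D}_{a}^{-}X)={}_{\eta}\mathcal{D}_{a}^{-}\underline{h}^{*}(X).$$ Reciprocally, given any $\eta$-compatible pair $({}_{\eta}\mathcal{D}_{a}^{+},{}_{\eta}\mathcal{D}_{a}^{-})$ there is a unique $g$-compatible pair $({}_{g}\mathcal{D}_{a}^{+},{}_{g}\mathcal{D}_{a}^{-})$ such that $\underline{h}({}_{g}\mathcal{D}_{a}^{+}X)={}_{\eta}\mathcal{D}_{a}^{+}\underline{h}(X)$ and $\underline{h}^{*}({}_{g}\mathcal{D}_{a}^{-}X)={}_{\eta}\mathcal{D}_{a}^{-}\underline{h}^{*}(X)$ for all $X\in\mathcal{M}(U)$ (and all directions $a$).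
   Context: $M$ is an $n$-dimensional smooth manifold, $(U_o,\phi_o)$ a chart with coordinates $x^1,\dots,x^n$, and $U\subset U_o$ open. The canonical space $\mathcal{U}_o$ is an $n$-dimensional real vector space with basis $b_1,\dots,b_n$ and the Euclidean scalar product $b_\mu\cdot b_\nu=\delta_{\mu\nu}$ ($b_\mu$ represents the coordinate field $\partial/\partial x^\mu$). The scalar product is extended to $\bigwedge\mathcal{U}_o$ by $(v_1\wedge\dots\wedge v_k)\cdot(w_1\wedge\dots\wedge w_k)=\det(v_i\cdot w_j)$, different grades being orthogonal. $\mathcal{S}(U),\mathcal{V}(U),\mathcal{M}(U)$ denote smooth maps from $U$ to $\mathbb{R},\mathcal{U}_o,\bigwedge\mathcal{U}_o$. For $a\in\mathcal{U}_o$, $a\cdot\partial_o X=\sum_\mu(a\cdot b_\mu)\,\partial X/\partial x^\mu$ (componentwise). For a vector $v$, $v\lrcorner X$ is the left contraction (interior product by $v$ using the Euclidean scalar product). A smooth $(1,1)$-extensor field is a smooth map from $U$ to the linear endomorphisms of $\mathcal{U}_o$; ${}^\dagger$ is the Euclidean adjoint; $t^{*}=(t^{-1})^{\dagger}$; $\underline{t}$ is the extension of $t$ to $\bigwedge\mathcal{U}_o$ as exterior algebra homomorphism ($\underline t(f)=f$ on scalars), and $\underline{t}^{*}=\underline{(t^* )}$. A connection field is a smooth map $\gamma$ on $U$ whose values are bilinear maps $\mathcal{U}_o\times\mathcal{U}_o\to\mathcal{U}_o$; write $\gamma_a(b)=\gamma(a,b)$ and $\Gamma_a(X)=\sum_\mu\gamma_a(b_\mu)\wedge(b_\mu\lrcorner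 X)$. A pair of $a$-directional covariant derivative operators is a pair (for each direction $a$) associated to some connection field $\gamma$ by $\nabla_a^{+}X=a\cdot\partial_oX+\Gamma_a(X)$, $\nabla_a^{-}X=a\cdot\partial_oX-\Gamma_a^{\dagger}(X)$, for $X\in\mathcal{M}(U)$. A metric field is a smooth $(1,1)$-extensor field $g$ on $U$ with $g=g^\dagger$ and $\det[g]\neq0$ everywhere. A pair $(\nabla^+_a,\nabla^-_a)$ is $g$-compatible if $\nabla_a^{++}g=0$ for all $a$, where $(\nabla_a^{++}g)(b)=\nabla_a^{-}(g(b))-g(\nabla_a^{+}b)$ for $b\in\mathcal{V}(U)$. A pseudo-orthogonal metric field is a metric field $\eta$ with $\eta=\eta^{\dagger}=\eta^{-1}$. *)

theory Defs
  imports "HOL-Analysis.Analysis"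
begin

section \<open>Smooth functions and smooth manifolds\<close>

text \<open>\<open>Ck_on k S f\<close> is meant for open \<open>S\<close>, where it says that \<open>f\<close> is \<open>k\<close> times continuously
  differentiable on \<open>S\<close>; it then depends only on the values of \<open>f\<close> on \<open>S\<close>.\<close>

primrec Ck_on :: "nat \<Rightarrow> 'a::euclidean_space set \<Rightarrow> ('a \<Rightarrow> 'b::real_normed_vector) \<Rightarrow> bool" where
  "Ck_on 0 S f \<longleftrightarrow> continuous_on S f"
| "Ck_on (Suc k) S f \<longleftrightarrow>
     f differentiable_on S \<and> (\<forall>v. Ck_on k S (\<lambda>x. frechet_derivative f (at x) v))"

definition smooth_on :: "'a::euclidean_space set \<Rightarrow> ('a \<Rightarrow> 'b::real_normed_vector) \<Rightarrow> bool" where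
  "smooth_on S f \<longleftrightarrow> (\<forall>k. Ck_on k S f)"

type_synonym 'n canonical = "(real, 'n) vec"

type_synonym ('m, 'n) chart = "'m set \<times> ('m \<Rightarrow> 'n canonical)"

definition is_chart :: "('m::topological_space, 'n::finite) chart \<Rightarrow> bool" where
  "is_chart c \<longleftrightarrow> (case c of (V, \<psi>) \<Rightarrow>
     open V \<and> open (\<psi> ` V) \<and> (\<exists>\<psi>'. homeomorphism V (\<psi> ` V) \<psi> \<psi>'))"

definition smooth_atlas :: "('m::topological_space, 'n::finite) chart set \<Rightarrow> bool" where
  "smooth_atlas A \<longleftrightarrow>
     (\<forall>c\<in>A. is_chart c) \<and> (\<Union>c\<in>A. fst c) = UNIV \<and>
     (\<forall>(V, \<psi>)\<in>A. \<forall>(W, \<xi>)\<in>A. smooth_on (\<psi> ` (V \<inter> W)) (\<xi> \<circ> inv_into V \<psi>))"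

definition smooth_map ::
  "('m, 'n::finite) chart set \<Rightarrow> 'm set \<Rightarrow> ('m \<Rightarrow> 'b::real_normed_vector) \<Rightarrow> bool" where
  "smooth_map A U f \<longleftrightarrow> (\<forall>(V, \<psi>)\<in>A. smooth_on (\<psi> ` (U \<inter> V)) (f \<circ> inv_into V \<psi>))"


section \<open>The exterior algebra of the canonical space\<close>

type_synonym 'n multivector = "(real, 'n set) vec"

text \<open>The canonical space is \<^typ>\<open>'n canonical\<close> with basis \<open>b\<^sub>\<mu> = axis \<mu> 1\<close> and its inner product; the
  linear order on \<^typ>\<open>'n\<close> only serves to enumerate the basis.
  The multivector \<open>axis S 1\<close> is the basis blade \<open>b\<^bsub>i1\<^esub> \<and> \<dots> \<and> b\<^bsub>ik\<^esub>\<close>, where \<open>S = {i1 < \<dots> < ik}\<close>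
  (lemma \<open>wedge_basis_eq_axis\<close> below). By the Gram determinant formula these blades are orthonormal
  for the scalar product extended to the exterior algebra, so that the latter is the library inner
  product of \<^typ>\<open>'n multivector\<close>.\<close>

definition scalar_mv :: "real \<Rightarrow> 'n::finite multivector" where
  "scalar_mv r = axis {} r"

definition vector_mv :: "'n canonical \<Rightarrow> 'n::finite multivector" where
  "vector_mv v = (\<Sum>i\<in>UNIV. axis {i} (v $ i))"

text \<open>Projection onto grade 1, a left inverse of \<^const>\<open>vector_mv\<close>.\<close>

definition vector_part :: "'n::finite multivector \<Rightarrow> 'n canonical" where
  "vector_part X = (\<chi> i. X $ {i})"

text \<open>The sign of the permutation that sorts the increasing enumeration of \<open>S\<close> followed by that of
  \<open>T\<close>, for disjoint \<open>S\<close> and \<open>T\<close>.\<close>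

definition shuffle_sign :: "'n::{finite,linorder} set \<Rightarrow> 'n set \<Rightarrow> real" where
  "shuffle_sign S T = (-1) ^ card {(i, j). i \<in> S \<and> j \<in> T \<and> j < i}"

definition wedge ::
  "'n::{finite,linorder} multivector \<Rightarrow> 'n multivector \<Rightarrow> 'n multivector" (infixr "\<and>\<^sub>m" 75) where
  "X \<and>\<^sub>m Y = (\<chi> R. \<Sum>S\<in>Pow R. shuffle_sign S (R - S) * (X $ S) * (Y $ (R - S)))"

definition wedge_list :: "'n::{finite,linorder} multivector list \<Rightarrow> 'n multivector" where
  "wedge_list Xs = foldr wedge Xs (scalar_mv 1)"

text \<open>Left contraction by a vector: \<open>(v \<lrcorner> X) \<bullet> Y = X \<bullet> (v \<and> Y)\<close>.\<close>

definition left_contraction ::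
  "'n canonical \<Rightarrow> 'n::{finite,linorder} multivector \<Rightarrow> 'n multivector" where
  "left_contraction v = adjoint (\<lambda>Y. vector_mv v \<and>\<^sub>m Y)"

text \<open>The extension of \<open>t\<close> to an exterior algebra homomorphism, given by its values on the basis
  blades.\<close>

definition outermorphism ::
  "('n canonical \<Rightarrow> 'n canonical) \<Rightarrow> 'n::{finite,linorder} multivector \<Rightarrow> 'n multivector" where
  "outermorphism t X =
     (\<Sum>S\<in>UNIV. (X $ S) *\<^sub>R
        wedge_list (map (\<lambda>i. vector_mv (t (axis i 1))) (sorted_list_of_set S)))"

lemma wedge_axis_singleton:
  fixes S :: "'n::{finite,linorder} set"
  assumes "\<And>j. j \<in> S \<Longrightarrow> i < j"
  shows "axis {i} 1 \<and>\<^sub>m axis S 1 = axis (insert i S) 1"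
proof -
  have i: "i \<notin> S" using assms by blast
  have "{(a, b). a \<in> {i} \<and> b \<in> S \<and> b < a} = {}" using assms by force
  then have e: "shuffle_sign {i} S = 1" by (simp only: shuffle_sign_def card.empty power_0)
  have "(axis {i} 1 \<and>\<^sub>m axis S 1) $ R = axis (insert i S) 1 $ R" for R
  proof (cases "R = insert i S")
    case True
    have "(\<Sum>T\<in>Pow R. shuffle_sign T (R - T) * (axis {i} 1 $ T) * (axis S 1 $ (R - T)))
        = (\<Sum>T\<in>{{i}}. shuffle_sign T (R - T) * (axis {i} 1 $ T) * (axis S 1 $ (R - T)))"
      by (rule sum.mono_neutral_right) (auto simp: True axis_def)
    also have "R - {i} = S" using i True by auto
    then have "(\<Sum>T\<in>{{i}}. shuffle_sign T (R - T) * (axis {i} 1 $ T) * (axis S 1 $ (R - T))) = 1"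
      using e by (simp add: axis_def)
    finally show ?thesis by (simp add: wedge_def True axis_def)
  next
    case False
    then have "shuffle_sign T (R - T) * (axis {i} 1 $ T) * (axis S 1 $ (R - T)) = 0"
      if "T \<in> Pow R" for T
      using that by (auto simp: axis_def)
    then have "(\<Sum>T\<in>Pow R. shuffle_sign T (R - T) * (axis {i} 1 $ T) * (axis S 1 $ (R - T))) = 0"
      by (rule sum.neutral[OF ballI])
    with False show ?thesis by (simp add: wedge_def axis_def)
  qed
  then show ?thesis by (simp add: vec_eq_iff)
qed

lemma vector_mv_axis: "vector_mv (axis i 1) = axis {i} 1"
proof -
  have "vector_mv (axis i 1 :: real ^ 'a) = (\<Sum>j\<in>UNIV. if j = i then axis {i} 1 else 0)"
    unfolding vector_mv_def by (rule sum.cong) (auto simp: axis_def vec_eq_iff)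
  then show ?thesis by simp
qed

lemma wedge_basis_eq_axis:
  fixes S :: "'n::{finite,linorder} set"
  shows "wedge_list (map (\<lambda>i. vector_mv (axis i 1)) (sorted_list_of_set S)) = axis S 1"
proof -
  have "wedge_list (map (\<lambda>i. vector_mv (axis i 1)) xs) = axis (set xs) 1"
    if "sorted_wrt (<) xs" for xs :: "'n list"
    using that
    by (induction xs)
       (auto simp: wedge_list_def scalar_mv_def vector_mv_axis wedge_axis_singleton)
  from this[of "sorted_list_of_set S"] show ?thesis by simp
qed


section \<open>Fields on an open subset of a chart domain\<close>

text \<open>Scalar, vector and multivector fields on \<open>U\<close> are represented as extensional functions
  (\<open>undefined\<close> outside \<open>U\<close>), and operators on them as extensional functions on the set of
  fields, so that equality of fields and of operators is equality in HOL.\<close>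

definition smooth_fields ::
  "('m, 'n::finite) chart set \<Rightarrow> 'm set \<Rightarrow> ('m \<Rightarrow> 'b::real_normed_vector) set" where
  "smooth_fields A U = {X \<in> extensional U. smooth_map A U X}"

abbreviation vector_fields ::
  "('m, 'n::finite) chart set \<Rightarrow> 'm set \<Rightarrow> ('m \<Rightarrow> 'n canonical) set" where
  "vector_fields \<equiv> smooth_fields"

abbreviation multivector_fields ::
  "('m, 'n::finite) chart set \<Rightarrow> 'm set \<Rightarrow> ('m \<Rightarrow> 'n multivector) set" where
  "multivector_fields \<equiv> smooth_fields"

type_synonym ('m, 'n) extensor_field = "'m \<Rightarrow> ('n canonical \<Rightarrow>\<^sub>L 'n canonical)"

definition coord_partial ::
  "('m, 'n::finite) chart \<Rightarrow> 'n \<Rightarrow> ('m \<Rightarrow> 'b::real_normed_vector) \<Rightarrow> 'm \<Rightarrow> 'b" where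
  "coord_partial c \<mu> X p = (case c of (V, \<phi>) \<Rightarrow>
     vector_derivative (\<lambda>s. X (inv_into V \<phi> (\<phi> p + s *\<^sub>R axis \<mu> 1))) (at 0))"

definition dir_deriv ::
  "('m, 'n::finite) chart \<Rightarrow> 'n canonical \<Rightarrow> ('m \<Rightarrow> 'b::real_normed_vector) \<Rightarrow> 'm \<Rightarrow> 'b" where
  "dir_deriv c a X p = (\<Sum>\<mu>\<in>UNIV. (a \<bullet> axis \<mu> 1) *\<^sub>R coord_partial c \<mu> X p)"

definition outer_ext ::
  "'m set \<Rightarrow> ('m, 'n::{finite,linorder}) extensor_field \<Rightarrow>
     ('m \<Rightarrow> 'n multivector) \<Rightarrow> 'm \<Rightarrow> 'n multivector" where
  "outer_ext U t X = (\<lambda>p\<in>U. outermorphism (blinfun_apply (t p)) (X p))"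

definition outer_ext_star ::
  "'m set \<Rightarrow> ('m, 'n::{finite,linorder}) extensor_field \<Rightarrow>
     ('m \<Rightarrow> 'n multivector) \<Rightarrow> 'm \<Rightarrow> 'n multivector" where
  "outer_ext_star U t X =
     (\<lambda>p\<in>U. outermorphism (adjoint (inv (blinfun_apply (t p)))) (X p))"


section \<open>Covariant derivative operators\<close>

type_synonym ('m, 'n) connection =
  "'m \<Rightarrow> ('n canonical \<Rightarrow>\<^sub>L ('n canonical \<Rightarrow>\<^sub>L 'n canonical))"

definition conn_ext ::
  "('n canonical \<Rightarrow>\<^sub>L ('n canonical \<Rightarrow>\<^sub>L 'n canonical)) \<Rightarrow> 'n canonical \<Rightarrow>
     'n::{finite,linorder} multivector \<Rightarrow> 'n multivector" where
  "conn_ext \<gamma> a X =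
     (\<Sum>\<mu>\<in>UNIV. vector_mv (blinfun_apply (blinfun_apply \<gamma> a) (axis \<mu> 1)) \<and>\<^sub>m
               left_contraction (axis \<mu> 1) X)"

text \<open>An operator takes the direction, then the field; a pair of operators is \<open>(\<nabla>\<^sup>+, \<nabla>\<^sup>-)\<close>.\<close>

type_synonym ('m, 'n) operator =
  "'n canonical \<Rightarrow> ('m \<Rightarrow> 'n multivector) \<Rightarrow> 'm \<Rightarrow> 'n multivector"

definition cov_plus ::
  "('m, 'n::{finite,linorder}) chart set \<Rightarrow> ('m, 'n) chart \<Rightarrow> 'm set \<Rightarrow>
     ('m, 'n) connection \<Rightarrow> ('m, 'n) operator" where
  "cov_plus A c U \<gamma> a =
     (\<lambda>X\<in>multivector_fields A U. \<lambda>p\<in>U. dir_deriv c a X p + conn_ext (\<gamma> p) a (X p))"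

definition cov_minus ::
  "('m, 'n::{finite,linorder}) chart set \<Rightarrow> ('m, 'n) chart \<Rightarrow> 'm set \<Rightarrow>
     ('m, 'n) connection \<Rightarrow> ('m, 'n) operator" where
  "cov_minus A c U \<gamma> a =
     (\<lambda>X\<in>multivector_fields A U. \<lambda>p\<in>U. dir_deriv c a X p - adjoint (conn_ext (\<gamma> p) a) (X p))"

definition cov_deriv_pair ::
  "('m, 'n::{finite,linorder}) chart set \<Rightarrow> ('m, 'n) chart \<Rightarrow> 'm set \<Rightarrow>
     ('m, 'n) operator \<times> ('m, 'n) operator \<Rightarrow> bool" where
  "cov_deriv_pair A c U D \<longleftrightarrow>
     (\<exists>\<gamma>. smooth_map A U \<gamma> \<and> D = (cov_plus A c U \<gamma>, cov_minus A c U \<gamma>))"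

text \<open>\<open>(\<nabla>\<^sub>a\<^sup>+\<^sup>+ g)(b)\<close> as a multivector field. Here \<open>\<nabla>\<^sub>a\<^sup>+ b\<close> is of grade 1, and
  \<^const>\<open>vector_part\<close> reads it as a vector, to which \<open>g\<close> can be applied.\<close>

definition cov_pp ::
  "'m set \<Rightarrow> ('m, 'n::{finite,linorder}) operator \<times> ('m, 'n) operator \<Rightarrow> 'n canonical \<Rightarrow>
     ('m, 'n) extensor_field \<Rightarrow> ('m \<Rightarrow> 'n canonical) \<Rightarrow> 'm \<Rightarrow> 'n multivector" where
  "cov_pp U D a g b = (\<lambda>p\<in>U.
     snd D a (\<lambda>q\<in>U. vector_mv (blinfun_apply (g q) (b q))) p -
     vector_mv (blinfun_apply (g p) (vector_part (fst D a (\<lambda>q\<in>U. vector_mv (b q)) p))))"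

definition compatible_pair ::
  "('m, 'n::{finite,linorder}) chart set \<Rightarrow> ('m, 'n) chart \<Rightarrow> 'm set \<Rightarrow>
     ('m, 'n) extensor_field \<Rightarrow> ('m, 'n) operator \<times> ('m, 'n) operator \<Rightarrow> bool" where
  "compatible_pair A c U g D \<longleftrightarrow>
     cov_deriv_pair A c U D \<and>
     (\<forall>a. \<forall>b\<in>vector_fields A U. \<forall>p\<in>U. cov_pp U D a g b p = 0)"


section \<open>Metric fields and gauge metric fields\<close>

definition metric_field ::
  "('m, 'n::finite) chart set \<Rightarrow> 'm set \<Rightarrow> ('m, 'n) extensor_field \<Rightarrow> bool" where
  "metric_field A U g \<longleftrightarrow> smooth_map A U g \<and>
     (\<forall>p\<in>U. blinfun_apply (g p) = adjoint (blinfun_apply (g p)) \<and>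
            det (matrix (blinfun_apply (g p))) \<noteq> 0)"

definition pseudo_orthogonal_metric_field ::
  "('m, 'n::finite) chart set \<Rightarrow> 'm set \<Rightarrow> ('m, 'n) extensor_field \<Rightarrow> bool" where
  "pseudo_orthogonal_metric_field A U \<eta> \<longleftrightarrow> metric_field A U \<eta> \<and>
     (\<forall>p\<in>U. blinfun_apply (\<eta> p) = adjoint (blinfun_apply (\<eta> p)) \<and>
            adjoint (blinfun_apply (\<eta> p)) = inv (blinfun_apply (\<eta> p)))"

text \<open>The numbers of positive and of negative eigenvalues of a symmetric endomorphism, counted with
  multiplicity (the dimension of the eigenspace).\<close>

definition signature :: "('n::finite canonical \<Rightarrow> 'n canonical) \<Rightarrow> nat \<times> nat" where
  "signature t =
     ((\<Sum>l | 0 < l \<and> (\<exists>v. v \<noteq> 0 \<and> t v = l *\<^sub>R v). dim {v. t v = l *\<^sub>R v}),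
      (\<Sum>l | l < 0 \<and> (\<exists>v. v \<noteq> 0 \<and> t v = l *\<^sub>R v). dim {v. t v = l *\<^sub>R v}))"

definition gauge_metric_field ::
  "('m, 'n::finite) chart set \<Rightarrow> 'm set \<Rightarrow> ('m, 'n) extensor_field \<Rightarrow>
     ('m, 'n) extensor_field \<Rightarrow> ('m, 'n) extensor_field \<Rightarrow> bool" where
  "gauge_metric_field A U g \<eta> h \<longleftrightarrow>
     smooth_map A U h \<and> (\<forall>p\<in>U. det (matrix (blinfun_apply (h p))) \<noteq> 0) \<and>
     pseudo_orthogonal_metric_field A U \<eta> \<and>
     (\<forall>p\<in>U. signature (blinfun_apply (\<eta> p)) = signature (blinfun_apply (g p))) \<and>
     (\<forall>p\<in>U. blinfun_apply (g p) =
        adjoint (blinfun_apply (h p)) \<circ> blinfun_apply (\<eta> p) \<circ> blinfun_apply (h p))"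

end

theory Submission
  imports Defs
begin

text \<open>The operator \<open>\<nabla>\<^sub>a\<^sup>+\<close> of a connection \<open>\<gamma>\<close> is a derivation of the exterior product, and since
  \<open>\<Gamma>\<^sub>a\<^sup>\<dagger>\<close> is the derivation that extends \<open>\<gamma>\<^sub>a\<^sup>\<dagger>\<close>, the operator \<open>\<nabla>\<^sub>a\<^sup>-\<close> is the \<open>\<nabla>\<^sub>a\<^sup>+\<close> of \<open>- \<gamma>\<^sub>a\<^sup>\<dagger>\<close>.
  An outermorphism is determined by its values on vectors, hence it intertwines two such derivations
  as soon as it does so on grade 1. On vectors, \<open>h\<close> turns \<open>\<gamma>\<close> into
  \<open>\<gamma>'\<^sub>a = h \<circ> \<gamma>\<^sub>a \<circ> h\<inverse> - (a\<cdot>\<partial> h) \<circ> h\<inverse>\<close>, and \<open>h\<^sup>*\<close> turns \<open>- \<gamma>\<^sub>a\<^sup>\<dagger>\<close> into \<open>- \<gamma>'\<^sub>a\<^sup>\<dagger>\<close> for the same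
  \<open>\<gamma>'\<close>. Compatibility is carried over because \<open>\<eta> = h\<^sup>* \<circ> g \<circ> h\<inverse>\<close>, and uniqueness holds because
  \<open>h\<close> and \<open>h\<^sup>*\<close> act bijectively on multivector fields. The converse is the same statement for \<open>h\<inverse>\<close>.\<close>


section \<open>Calculus of \<open>C\<^sup>k\<close> functions on open sets\<close>

lemma has_derivative_cong_open:
  assumes "open S" "x \<in> S" "\<And>y. y \<in> S \<Longrightarrow> f y = g y"
  shows "(f has_derivative D) (at x) \<longleftrightarrow> (g has_derivative D) (at x)"
  using has_derivative_transform_within_open[OF _ assms(1,2), of f D UNIV g]
    has_derivative_transform_within_open[OF _ assms(1,2), of g D UNIV f] assms(3) by auto

lemma frechet_derivative_cong_open:
  assumes "open S" "x \<in> S" "\<And>y. y \<in> S \<Longrightarrow> f y = g y"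
  shows "frechet_derivative f (at x) = frechet_derivative g (at x)"
  using has_derivative_cong_open[OF assms] by (simp add: frechet_derivative_def)

lemma has_frechet_derivative_on:
  assumes "f differentiable_on S" "open S" "x \<in> S"
  shows "(f has_derivative frechet_derivative f (at x)) (at x)"
  using assms by (metis differentiable_on_eq_differentiable_at frechet_derivative_works)

lemma frechet_derivativeI:
  "(f has_derivative D) (at x) \<Longrightarrow> frechet_derivative f (at x) v = D v"
  by (metis frechet_derivative_at)

text \<open>A derivative at a point of an open set sees only nearby values, so agreement on
  \<open>S\<close> passes to all derivatives; hence \<open>f\<close> and \<open>g\<close> vary in
  the induction.\<close>

lemma Ck_on_cong:
  assumes "open S" "\<And>x. x \<in> S \<Longrightarrow> f x = g x"
  shows "Ck_on k S f \<longleftrightarrow> Ck_on k S g"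
  using assms(2)
proof (induction k arbitrary: f g)
  case 0
  then show ?case using continuous_on_cong[of S S f g] by simp
next
  case (Suc k)
  have "f differentiable_on S \<longleftrightarrow> g differentiable_on S"
    using has_derivative_cong_open[OF assms(1) _ Suc.prems]
    by (auto simp: differentiable_on_eq_differentiable_at[OF assms(1)] differentiable_def)
  moreover have "Ck_on k S (\<lambda>x. frechet_derivative f (at x) v) \<longleftrightarrow>
      Ck_on k S (\<lambda>x. frechet_derivative g (at x) v)" for v
    using frechet_derivative_cong_open[OF assms(1) _ Suc.prems] by (intro Suc.IH) simp
  ultimately show ?case by simp
qed

lemma Ck_on_SucD: "Ck_on (Suc k) S f \<Longrightarrow> Ck_on k S f"
proof (induction k arbitrary: f)
  case 0
  then show ?case by (simp add: differentiable_imp_continuous_on)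
next
  case (Suc k)
  then show ?case unfolding Ck_on.simps(2)[of "Suc k" S f] Ck_on.simps(2)[of k S f] by blast
qed

lemma Ck_on_subset: "Ck_on k S f \<Longrightarrow> T \<subseteq> S \<Longrightarrow> Ck_on k T f"
  by (induction k arbitrary: f) (auto intro: continuous_on_subset differentiable_on_subset)

text \<open>Lets an explicit derivative \<open>D\<close> replace the one chosen by
  \<open>frechet_derivative\<close>, so that closure properties reduce to differentiation
  rules.\<close>

lemma Ck_on_SucI:
  assumes "open S" "\<And>x. x \<in> S \<Longrightarrow> (f has_derivative D x) (at x)"
    and "\<And>v. Ck_on k S (\<lambda>x. D x v)"
  shows "Ck_on (Suc k) S f"
proof -
  have "Ck_on k S (\<lambda>x. frechet_derivative f (at x) v)" for v
    using Ck_on_cong[OF assms(1), of "\<lambda>x. frechet_derivative f (at x) v" "\<lambda>x. D x v"]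
      frechet_derivativeI[OF assms(2)] assms(3) by simp
  moreover have "f differentiable_on S"
    using assms(1,2) by (auto simp: differentiable_on_eq_differentiable_at differentiable_def)
  ultimately show ?thesis by simp
qed

lemma Ck_on_const: "open S \<Longrightarrow> Ck_on k S (\<lambda>x. c)"
proof (induction k arbitrary: c)
  case (Suc k)
  then show ?case by (intro Ck_on_SucI[where D = "\<lambda>x v. 0"]) auto
qed simp

lemma Ck_on_linear:
  assumes "open S" "bounded_linear L" "Ck_on k S f"
  shows "Ck_on k S (\<lambda>x. L (f x))"
  using assms(3)
proof (induction k arbitrary: f)
  case 0
  then show ?case using assms(2) by (auto intro: bounded_linear.continuous_on)
next
  case (Suc k)
  then show ?case
    using has_frechet_derivative_on[of f S] assms(1)
    by (intro Ck_on_SucI[where D = "\<lambda>x v. L (frechet_derivative f (at x) v)"])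
       (auto intro: bounded_linear.has_derivative[OF assms(2)])
qed

lemma Ck_on_add:
  assumes "open S" "Ck_on k S f" "Ck_on k S g"
  shows "Ck_on k S (\<lambda>x. f x + g x)"
  using assms(2,3)
proof (induction k arbitrary: f g)
  case (Suc k)
  then show ?case
    using has_frechet_derivative_on[of f S] has_frechet_derivative_on[of g S] assms(1)
    by (intro Ck_on_SucI[where
          D = "\<lambda>x v. frechet_derivative f (at x) v + frechet_derivative g (at x) v"])
       (auto intro: has_derivative_add)
qed (auto intro: continuous_on_add)

lemma Ck_on_bilinear:
  assumes "open S" "bounded_bilinear B" "Ck_on k S f" "Ck_on k S g"
  shows "Ck_on k S (\<lambda>x. B (f x) (g x))"
  using assms(3,4)
proof (induction k arbitrary: f g)
  case 0
  then show ?case using bounded_bilinear.continuous_on[OF assms(2)] by simp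
next
  case (Suc k)
  \<comment> \<open>Both summands of the product rule are again values of \<open>B\<close>, each
    with one undifferentiated factor, which is now taken only to order \<open>k\<close>.\<close>
  note fg = Ck_on_SucD[OF Suc.prems(1)] Ck_on_SucD[OF Suc.prems(2)]
  show ?case
  proof (rule Ck_on_SucI[OF assms(1)])
    fix x assume x: "x \<in> S"
    show "((\<lambda>x. B (f x) (g x)) has_derivative (\<lambda>v. B (f x) (frechet_derivative g (at x) v) +
        B (frechet_derivative f (at x) v) (g x))) (at x)"
      using Suc.prems x assms(1)
      by (intro bounded_bilinear.FDERIV[OF assms(2)] has_frechet_derivative_on) auto
  next
    fix v
    show "Ck_on k S (\<lambda>x. B (f x) (frechet_derivative g (at x) v) +
        B (frechet_derivative f (at x) v) (g x))"
      using Suc.prems fg by (intro Ck_on_add assms(1) Suc.IH) auto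
  qed
qed

lemma Ck_on_sum:
  assumes "open S" "\<And>i. i \<in> I \<Longrightarrow> Ck_on k S (f i)"
  shows "Ck_on k S (\<lambda>x. \<Sum>i\<in>I. f i x)"
  using assms(2)
  by (induction I rule: infinite_finite_induct) (auto intro: Ck_on_const Ck_on_add assms(1))

text \<open>The derivative of 1/f is -(1/f) f' (1/f). It involves only f' and 1/f itself, to which
  the induction hypothesis applies.\<close>

lemma Ck_on_inverse:
  fixes f :: "'a::euclidean_space \<Rightarrow> real"
  assumes "open S" "\<And>x. x \<in> S \<Longrightarrow> f x \<noteq> 0" "Ck_on k S f"
  shows "Ck_on k S (\<lambda>x. inverse (f x))"
  using assms(3)
proof (induction k)
  case 0
  then show ?case using assms(2) by (auto intro: continuous_on_inverse)
next
  case (Suc k)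
  note f = Ck_on_SucD[OF Suc.prems]
  show ?case
  proof (rule Ck_on_SucI[OF assms(1)])
    fix x assume x: "x \<in> S"
    show "((\<lambda>x. inverse (f x)) has_derivative
        (\<lambda>v. - 1 * (inverse (f x) * (frechet_derivative f (at x) v * inverse (f x))))) (at x)"
      using Deriv.has_derivative_inverse[OF assms(2)[OF x] has_frechet_derivative_on[of f S x]]
        Suc.prems x assms(1) by (simp add: mult.assoc)
  next
    fix v
    show "Ck_on k S (\<lambda>x. - 1 * (inverse (f x) * (frechet_derivative f (at x) v * inverse (f x))))"
      using Suc f by (intro Ck_on_bilinear[OF assms(1) bounded_bilinear_mult] Ck_on_const assms(1)) auto
  qed
qed

text \<open>Induction by the chain rule; each directional derivative of \<open>f\<close> is a new
  outer function of one order less, so \<open>f\<close> varies while \<open>g\<close> stays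
  fixed.\<close>

lemma Ck_on_compose:
  fixes g :: "'a::euclidean_space \<Rightarrow> 'b::euclidean_space"
  assumes "open S" "open T" "g ` S \<subseteq> T" "Ck_on k T f" "Ck_on k S g"
  shows "Ck_on k S (f \<circ> g)"
  using assms(4,5)
proof (induction k arbitrary: f)
  case 0
  then have "continuous_on (g ` S) f" using assms(3) continuous_on_subset by auto
  then show ?case using 0 continuous_on_compose[of S g f] by simp
next
  case (Suc k)
  let ?f' = "\<lambda>b y. frechet_derivative f (at y) b"
  show ?case
  proof (rule Ck_on_SucI[OF assms(1)])
    fix x assume x: "x \<in> S"
    then have gx: "g x \<in> T" using assms(3) by auto
    have f: "(f has_derivative frechet_derivative f (at (g x))) (at (g x))"
      using has_frechet_derivative_on[of f T] Suc.prems gx assms(2) by simp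
    have g: "(g has_derivative frechet_derivative g (at x)) (at x)"
      using has_frechet_derivative_on[of g S] Suc.prems x assms(1) by simp
    \<comment> \<open>The direction fed into the derivative of \<open>f\<close> depends on
      \<open>x\<close>, whereas \<open>Ck_on\<close> controls fixed directions only. Expansion in
      \<open>Basis\<close> moves this dependence into scalar coefficients.\<close>
    have *: "frechet_derivative f (at (g x)) w = (\<Sum>b\<in>Basis. (w \<bullet> b) *\<^sub>R (?f' b \<circ> g) x)" for w
      using arg_cong[OF euclidean_representation[of w], of "frechet_derivative f (at (g x))"]
      by (simp add: linear_sum[OF has_derivative_linear[OF f]] linear_cmul[OF has_derivative_linear[OF f]])
    show "((f \<circ> g) has_derivative (\<lambda>v. \<Sum>b\<in>Basis. (frechet_derivative g (at x) v \<bullet> b) *\<^sub>R (?f' b \<circ> g) x)) (at x)"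
      by (rule has_derivative_eq_rhs[OF diff_chain_at[OF g f]]) (rule ext, unfold comp_apply, rule *[unfolded comp_apply])
  next
    fix v
    show "Ck_on k S (\<lambda>x. \<Sum>b\<in>Basis. (frechet_derivative g (at x) v \<bullet> b) *\<^sub>R (?f' b \<circ> g) x)"
      using Suc.prems Ck_on_SucD[OF Suc.prems(2)]
      by (intro Ck_on_sum Ck_on_bilinear[OF assms(1) bounded_bilinear_scaleR] Suc.IH
          Ck_on_linear[OF assms(1) bounded_linear_inner_left] assms(1)) auto
  qed
qed


section \<open>Vectors in the exterior algebra\<close>

lemma axis_unit_sum: "(\<Sum>i\<in>UNIV. (x $ i) *\<^sub>R axis i 1) = (x :: real ^ 'k)"
  by (simp add: vec_eq_iff axis_def if_distrib cong: if_cong)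

lemma linear_axis_sum:
  fixes f :: "real ^ 'k \<Rightarrow> 'b::real_vector"
  assumes "linear f"
  shows "f x = (\<Sum>i\<in>UNIV. (x $ i) *\<^sub>R f (axis i 1))"
  using arg_cong[OF axis_unit_sum[of x], of f] by (simp add: linear_sum[OF assms] linear_cmul[OF assms])

text \<open>Reduces linear identities to basis elements, both for vectors and, with sets as indices,
  for multivectors and blades.\<close>

lemma linear_eq_on_axis:
  fixes f g :: "real ^ 'k \<Rightarrow> 'b::real_vector"
  assumes "linear f" "linear g" "\<And>i. f (axis i 1) = g (axis i 1)"
  shows "f x = g x"
  using linear_axis_sum[OF assms(1), of x] linear_axis_sum[OF assms(2), of x] assms(3) by simp

lemma scalar_mv_eq: "scalar_mv r = r *\<^sub>R axis {} 1"
  by (simp add: scalar_mv_def vec_eq_iff axis_def)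

section \<open>Exterior multiplication by vectors\<close>

lemma bilinear_wedge: "bilinear wedge"
  unfolding bilinear_def wedge_def
  by (auto intro!: linearI simp: vec_eq_iff algebra_simps sum.distrib sum_distrib_left)

lemma bounded_bilinear_wedge: "bounded_bilinear wedge"
  using bilinear_wedge by (simp add: bilinear_conv_bounded_bilinear)

lemmas wedge_simps =
  bounded_bilinear.add_left[OF bounded_bilinear_wedge]
  bounded_bilinear.add_right[OF bounded_bilinear_wedge]
  bounded_bilinear.zero_left[OF bounded_bilinear_wedge]
  bounded_bilinear.zero_right[OF bounded_bilinear_wedge]
  bounded_bilinear.minus_left[OF bounded_bilinear_wedge]
  bounded_bilinear.minus_right[OF bounded_bilinear_wedge]
  bounded_bilinear.diff_left[OF bounded_bilinear_wedge]
  bounded_bilinear.diff_right[OF bounded_bilinear_wedge]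
  bounded_bilinear.scaleR_left[OF bounded_bilinear_wedge]
  bounded_bilinear.scaleR_right[OF bounded_bilinear_wedge]
  bounded_bilinear.sum_left[OF bounded_bilinear_wedge]
  bounded_bilinear.sum_right[OF bounded_bilinear_wedge]

lemma linear_wedge_right: "linear (\<lambda>Y. X \<and>\<^sub>m Y)"
  using bilinear_wedge by (auto simp: bilinear_def)

lemma linear_vector_mv: "linear vector_mv"
  unfolding vector_mv_def
  by (rule linearI) (auto simp: vec_eq_iff axis_def sum.distrib sum_distrib_left if_distrib
      cong: if_cong intro!: sum.cong simp flip: sum.distrib)

lemma bounded_linear_vector_mv: "bounded_linear vector_mv"
  using linear_vector_mv by (simp add: linear_conv_bounded_linear)

lemmas vector_mv_simps = linear_add[OF linear_vector_mv] linear_cmul[OF linear_vector_mv]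
  linear_diff[OF linear_vector_mv] linear_neg[OF linear_vector_mv] linear_0[OF linear_vector_mv]

lemma vector_part_vector_mv [simp]: "vector_part (vector_mv v) = v"
  by (simp add: vector_part_def vector_mv_def vec_eq_iff axis_def if_distrib eq_commute cong: if_cong)

lemma wedge_vector_axis:
  fixes S :: "'n::{finite,linorder} set"
  shows "vector_mv (axis i 1) \<and>\<^sub>m axis S 1 =
    (if i \<in> S then 0 else shuffle_sign {i} S *\<^sub>R axis (insert i S) 1)"
proof -
  have "(axis {i} 1 \<and>\<^sub>m axis S 1) $ R =
      (if i \<in> S then 0 else shuffle_sign {i} S *\<^sub>R axis (insert i S) 1) $ R" for R
  proof -
    \<comment> \<open>Of all splittings of \<open>R\<close>, only that into \<open>{i}\<close> and
      the rest can contribute, and only if the rest is \<open>S\<close>; this forces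
      \<open>i \<notin> S\<close>.\<close>
    have "(axis {i} 1 \<and>\<^sub>m axis S 1) $ R =
        (\<Sum>T\<in>Pow R. if T = {i} \<and> S = R - {i} then shuffle_sign {i} S else 0)"
      unfolding wedge_def by (auto simp: axis_def intro!: sum.cong)
    also have "\<dots> = (if {i} \<in> Pow R \<and> S = R - {i} then shuffle_sign {i} S else 0)"
      by (cases "S = R - {i}") auto
    also have "\<dots> = (if i \<in> S then 0 else shuffle_sign {i} S *\<^sub>R axis (insert i S) 1) $ R"
      by (auto simp: axis_def)
    finally show ?thesis .
  qed
  then show ?thesis by (simp add: vec_eq_iff vector_mv_axis)
qed

text \<open>With one index on the left, the exponent counts the elements below \<open>i\<close>;
  inserting \<open>j\<close> changes this count exactly when \<open>j < i\<close>.\<close>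

lemma shuffle_sign_insert:
  fixes S :: "'n::{finite,linorder} set"
  assumes "j \<notin> S"
  shows "shuffle_sign {i} (insert j S) = (if j < i then - 1 else 1) * shuffle_sign {i} S"
proof -
  have e: "{(a, b). a \<in> {i} \<and> b \<in> T \<and> b < a} = Pair i ` {b \<in> T. b < i}" for T :: "'n set"
    by auto
  have c: "card {(a, b). a \<in> {i} \<and> b \<in> T \<and> b < a} = card {b \<in> T. b < i}" for T :: "'n set"
    unfolding e by (rule card_image) (auto simp: inj_on_def)
  have "{b \<in> insert j S. b < i} = (if j < i then insert j {b \<in> S. b < i} else {b \<in> S. b < i})"
    by auto
  then show ?thesis using assms unfolding shuffle_sign_def c by auto
qed

lemma shuffle_sign_square [simp]: "shuffle_sign S T * shuffle_sign S T = 1"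
  by (simp add: shuffle_sign_def flip: power_add)

text \<open>For distinct indices the two orders of insertion differ in a single inversion, that
  between \<open>i\<close> and \<open>j\<close>; equal indices give zero.\<close>

lemma wedge_basis_anticommute:
  fixes S :: "'n::{finite,linorder} set"
  shows "vector_mv (axis i 1) \<and>\<^sub>m vector_mv (axis j 1) \<and>\<^sub>m axis S 1 =
    - (vector_mv (axis j 1) \<and>\<^sub>m vector_mv (axis i 1) \<and>\<^sub>m axis S 1)"
  by (cases "i = j"; cases "i < j")
     (auto simp: wedge_vector_axis wedge_simps shuffle_sign_insert insert_commute mult.commute)

text \<open>Both sides are trilinear, so the basis case extends through \<open>X\<close>,
  \<open>w\<close> and \<open>v\<close> in turn. Vectors can thus be reordered in products built up
  from the left, without appeal to associativity.\<close>

lemma wedge_anticommute: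
  "vector_mv v \<and>\<^sub>m vector_mv w \<and>\<^sub>m X = - (vector_mv w \<and>\<^sub>m vector_mv v \<and>\<^sub>m X)"
proof -
  have 1: "vector_mv (axis i 1) \<and>\<^sub>m vector_mv (axis j 1) \<and>\<^sub>m X =
      - (vector_mv (axis j 1) \<and>\<^sub>m vector_mv (axis i 1) \<and>\<^sub>m X)" for i j
    by (rule linear_eq_on_axis[where x = X], (auto intro!: linearI simp: wedge_simps)[2])
       (rule wedge_basis_anticommute)
  have 2: "vector_mv (axis i 1) \<and>\<^sub>m vector_mv w \<and>\<^sub>m X =
      - (vector_mv w \<and>\<^sub>m vector_mv (axis i 1) \<and>\<^sub>m X)" for i
    by (rule linear_eq_on_axis[where x = w],
        (auto intro!: linearI simp: vector_mv_simps wedge_simps)[2]) (rule 1)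
  show ?thesis
    by (rule linear_eq_on_axis[where x = v],
        (auto intro!: linearI simp: vector_mv_simps wedge_simps)[2]) (rule 2)
qed

lemma wedge_vector_square: "vector_mv v \<and>\<^sub>m vector_mv v \<and>\<^sub>m X = 0"
proof -
  have "2 *\<^sub>R (vector_mv v \<and>\<^sub>m vector_mv v \<and>\<^sub>m X) = 0"
    using wedge_anticommute[of v v X] by (simp only: scaleR_2 eq_neg_iff_add_eq_0)
  then show ?thesis by simp
qed

section \<open>Contraction by a vector, the adjoint of exterior multiplication\<close>

lemma left_contraction_inner: "left_contraction v X \<bullet> Y = X \<bullet> (vector_mv v \<and>\<^sub>m Y)"
  unfolding left_contraction_def
  using adjoint_works[OF linear_wedge_right, of Y "vector_mv v" X] by (simp add: inner_commute)

lemma wedge_inner: "(vector_mv v \<and>\<^sub>m Y) \<bullet> X = Y \<bullet> left_contraction v X"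
  using left_contraction_inner[of v X Y] by (simp add: inner_commute)

lemma left_contraction_add:
  "left_contraction (v + w) X = left_contraction v X + left_contraction w X"
  "left_contraction v (X + Y) = left_contraction v X + left_contraction v Y"
  by (rule vector_eq_rdot[THEN iffD1],
      simp add: left_contraction_inner inner_add_left inner_add_right vector_mv_simps wedge_simps)+

lemma left_contraction_scaleR:
  "left_contraction (c *\<^sub>R v) X = c *\<^sub>R left_contraction v X"
  "left_contraction v (c *\<^sub>R X) = c *\<^sub>R left_contraction v X"
  by (rule vector_eq_rdot[THEN iffD1], simp add: left_contraction_inner vector_mv_simps wedge_simps)+

lemma linear_left_contraction: "linear (left_contraction v)"
  and linear_left_contraction_left: "linear (\<lambda>v. left_contraction v X)"
  by (auto intro!: linearI simp: left_contraction_add left_contraction_scaleR)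

lemma axis_set_inner: "axis S 1 \<bullet> (axis T 1 :: real ^ 'k) = (if S = T then 1 else 0)"
  by (simp add: inner_axis_axis)

text \<open>Coefficients are inner products with blades, so this is the transpose of
  \<open>wedge_vector_axis\<close>.\<close>

lemma left_contraction_axis:
  fixes S :: "'n::{finite,linorder} set"
  shows "left_contraction (axis i 1) (axis S 1) =
    (if i \<in> S then shuffle_sign {i} (S - {i}) *\<^sub>R axis (S - {i}) 1 else 0)"
proof -
  have "left_contraction (axis i 1) (axis S 1) $ T =
      (if i \<in> S then shuffle_sign {i} (S - {i}) *\<^sub>R axis (S - {i}) 1 else 0) $ T" for T
  proof -
    have "left_contraction (axis i 1) (axis S 1) $ T = axis S 1 \<bullet> (vector_mv (axis i 1) \<and>\<^sub>m axis T 1)"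
      using left_contraction_inner[of "axis i 1" "axis S 1" "axis T 1"] by (simp add: inner_axis)
    also have "\<dots> = (if i \<in> S then shuffle_sign {i} (S - {i}) *\<^sub>R axis (S - {i}) 1 else 0) $ T"
      unfolding wedge_vector_axis using insert_Diff[of i S]
      by (simp add: axis_set_inner) (auto simp: axis_def)
    finally show ?thesis .
  qed
  then show ?thesis by (simp add: vec_eq_iff)
qed

text \<open>The antiderivation rule. Both sides are linear in each of the three arguments, which
  leaves a comparison of signs on blades.\<close>

lemma left_contraction_wedge:
  "left_contraction w (vector_mv v \<and>\<^sub>m X) = (w \<bullet> v) *\<^sub>R X - vector_mv v \<and>\<^sub>m left_contraction w X"
proof -
  have basis: "left_contraction (axis i 1) (vector_mv (axis j 1) \<and>\<^sub>m axis S 1) =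
      (axis i 1 \<bullet> (axis j 1 :: 'a canonical)) *\<^sub>R axis S 1 -
      vector_mv (axis j 1) \<and>\<^sub>m left_contraction (axis i 1) (axis S 1)" for i j :: 'a and S
  proof (cases "i = j")
    case True
    then show ?thesis
      by (auto simp: wedge_vector_axis left_contraction_axis left_contraction_scaleR wedge_simps
          linear_0[OF linear_left_contraction] insert_absorb axis_set_inner)
  next
    case False
    \<comment> \<open>Taking \<open>i\<close> out of \<open>S\<close> changes the sign of
      \<open>j\<close> iff \<open>i < j\<close>, and putting \<open>j\<close> in changes the sign of
      \<open>i\<close> iff \<open>j < i\<close>. Exactly one of the two happens, which leaves one
      minus sign.\<close>
    have sgn: "shuffle_sign {j} S * shuffle_sign {i} (insert j S - {i}) =
        - (shuffle_sign {i} (S - {i}) * shuffle_sign {j} (S - {i}))" if "i \<in> S" "j \<notin> S"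
    proof -
      have S: "S = insert i (S - {i})" "insert j S - {i} = insert j (S - {i})" using that False by auto
      have 1: "shuffle_sign {j} S = (if i < j then - 1 else 1) * shuffle_sign {j} (S - {i})"
        using shuffle_sign_insert[of i "S - {i}" j] S(1) by simp
      have 2: "shuffle_sign {i} (insert j S - {i}) =
          (if j < i then - 1 else 1) * shuffle_sign {i} (S - {i})"
        unfolding S(2) using that by (intro shuffle_sign_insert) auto
      show ?thesis unfolding 1 2 using False by (cases "i < j") auto
    qed
    have "insert j S - {i} = insert j (S - {i})" using False by auto
    then show ?thesis
      using False sgn
      by (auto simp: wedge_vector_axis left_contraction_axis left_contraction_scaleR wedge_simps
          linear_0[OF linear_left_contraction] axis_set_inner)
  qed
  note simps = vector_mv_simps wedge_simps left_contraction_add left_contraction_scaleR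
    inner_add_left inner_add_right algebra_simps
  have 1: "left_contraction (axis i 1) (vector_mv (axis j 1) \<and>\<^sub>m X) =
      (axis i 1 \<bullet> (axis j 1 :: 'a canonical)) *\<^sub>R X -
      vector_mv (axis j 1) \<and>\<^sub>m left_contraction (axis i 1) X" for i j
    by (rule linear_eq_on_axis[where x = X], (auto intro!: linearI simp: simps)[2]) (rule basis)
  have 2: "left_contraction (axis i 1) (vector_mv v \<and>\<^sub>m X) =
      (axis i 1 \<bullet> v) *\<^sub>R X - vector_mv v \<and>\<^sub>m left_contraction (axis i 1) X" for i
    by (rule linear_eq_on_axis[where x = v], (auto intro!: linearI simp: simps)[2]) (rule 1)
  show ?thesis
    by (rule linear_eq_on_axis[where x = w], (auto intro!: linearI simp: simps)[2]) (rule 2)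
qed

text \<open>The formula of \<open>conn_ext\<close> for a single map \<open>G\<close>, so that it
  covers both \<gamma>_a and the negative adjoint of \<gamma>_a, which governs the minus
  operator.\<close>

definition derivation_ext ::
  "('n canonical \<Rightarrow> 'n canonical) \<Rightarrow> 'n::{finite,linorder} multivector \<Rightarrow> 'n multivector" where
  "derivation_ext G X =
     (\<Sum>\<mu>\<in>UNIV. vector_mv (G (axis \<mu> 1)) \<and>\<^sub>m left_contraction (axis \<mu> 1) X)"

lemma linear_derivation_ext: "linear (derivation_ext G)"
  by (rule linearI)
     (simp_all add: derivation_ext_def left_contraction_add left_contraction_scaleR wedge_simps
       sum.distrib scaleR_sum_right)

text \<open>By the antiderivation rule the contractions produce the components of \<open>v\<close>,
  which assemble to \<open>G v\<close>, minus a term whose sign is restored by anticommuting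
  \<open>v\<close> with \<open>G (axis \<mu> 1)\<close>.\<close>

lemma derivation_ext_wedge:
  assumes "linear G"
  shows "derivation_ext G (vector_mv v \<and>\<^sub>m X) =
    vector_mv (G v) \<and>\<^sub>m X + vector_mv v \<and>\<^sub>m derivation_ext G X"
proof -
  have "vector_mv (G v) = (\<Sum>\<mu>\<in>UNIV. (v $ \<mu>) *\<^sub>R vector_mv (G (axis \<mu> 1)))"
    by (rule linear_axis_sum) (rule linear_compose[OF assms linear_vector_mv, unfolded o_def])
  then show ?thesis
    by (simp add: derivation_ext_def left_contraction_wedge wedge_simps wedge_anticommute[of v]
        sum.distrib inner_axis' sum_negf sum_subtractf)
qed

lemma derivation_ext_scalar:
  fixes G :: "'n::{finite,linorder} canonical \<Rightarrow> 'n canonical"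
  shows "derivation_ext G (scalar_mv r) = 0"
proof -
  have "left_contraction (axis \<mu> 1) (scalar_mv r) = 0" for \<mu> :: 'n
    by (simp add: scalar_mv_eq left_contraction_scaleR left_contraction_axis)
  then show ?thesis by (simp add: derivation_ext_def wedge_simps)
qed

text \<open>As products with the unit, vectors inherit their rules from those for scalars and for
  exterior multiplication by a vector.\<close>

lemma vector_mv_eq_wedge: "vector_mv v = vector_mv v \<and>\<^sub>m scalar_mv 1"
  unfolding scalar_mv_def
  by (rule linear_eq_on_axis[where x = v], (auto intro!: linearI simp: vector_mv_simps wedge_simps)[2])
     (simp add: vector_mv_axis wedge_axis_singleton[of "{}", simplified])

lemma derivation_ext_vector:
  assumes "linear G"
  shows "derivation_ext G (vector_mv v) = vector_mv (G v)"
proof -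
  have "derivation_ext G (vector_mv v \<and>\<^sub>m scalar_mv 1) = vector_mv (G v) \<and>\<^sub>m scalar_mv 1"
    by (simp only: derivation_ext_wedge[OF assms] derivation_ext_scalar wedge_simps add_0_right)
  then show ?thesis by (simp flip: vector_mv_eq_wedge)
qed

text \<open>Exterior multiplication and contraction by a vector are mutually adjoint. Taking the
  adjoint therefore exchanges the two indices of the double sum over the matrix entries of
  \<open>G\<close>, which amounts to transposing the matrix.\<close>

lemma adjoint_derivation_ext:
  assumes "linear G"
  shows "adjoint (derivation_ext G) = derivation_ext (adjoint G)"
proof (rule adjoint_unique, intro allI)
  fix X Y :: "'a multivector"
  let ?L = "\<lambda>\<mu>. left_contraction (axis \<mu> (1::real))"
  have lc: "left_contraction v Y = (\<Sum>\<nu>\<in>UNIV. (v $ \<nu>) *\<^sub>R ?L \<nu> Y)" for v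
    by (rule linear_axis_sum) (rule linear_left_contraction_left)
  have vm: "vector_mv v = (\<Sum>\<nu>\<in>UNIV. (v $ \<nu>) *\<^sub>R vector_mv (axis \<nu> 1))" for v :: "'a canonical"
    by (rule linear_axis_sum) (rule linear_vector_mv)
  have adj: "G (axis \<mu> 1) $ \<nu> = adjoint G (axis \<nu> 1) $ \<mu>" for \<mu> \<nu>
    using adjoint_works[OF assms, of "axis \<mu> 1" "axis \<nu> 1"] by (simp add: inner_axis inner_axis' inner_commute)
  have "derivation_ext G X \<bullet> Y = (\<Sum>\<mu>\<in>UNIV. ?L \<mu> X \<bullet> left_contraction (G (axis \<mu> 1)) Y)"
    by (simp add: derivation_ext_def inner_sum_left wedge_inner)
  also have "\<dots> = (\<Sum>\<mu>\<in>UNIV. \<Sum>\<nu>\<in>UNIV. (adjoint G (axis \<nu> 1) $ \<mu>) * (X \<bullet> (vector_mv (axis \<mu> 1) \<and>\<^sub>m ?L \<nu> Y)))"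
    unfolding lc[of "G x" for x] by (simp add: inner_sum_right adj left_contraction_inner)
  also have "\<dots> = (\<Sum>\<nu>\<in>UNIV. \<Sum>\<mu>\<in>UNIV. (adjoint G (axis \<nu> 1) $ \<mu>) * (X \<bullet> (vector_mv (axis \<mu> 1) \<and>\<^sub>m ?L \<nu> Y)))"
    by (rule sum.swap)
  also have "\<dots> = X \<bullet> derivation_ext (adjoint G) Y"
    unfolding derivation_ext_def vm[of "adjoint G x" for x] by (simp add: wedge_simps inner_sum_right)
  finally show "derivation_ext G X \<bullet> Y = X \<bullet> derivation_ext (adjoint G) Y" .
qed

section \<open>Outermorphisms\<close>

lemma linear_outermorphism: "linear (outermorphism t)"
  by (rule linearI) (simp_all add: outermorphism_def scaleR_add_left sum.distrib scaleR_sum_right)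

lemma outermorphism_axis:
  "outermorphism t (axis S 1) = wedge_list (map (\<lambda>i. vector_mv (t (axis i 1))) (sorted_list_of_set S))"
proof -
  have "outermorphism t (axis S 1) =
      (\<Sum>T\<in>UNIV. if T = S then wedge_list (map (\<lambda>i. vector_mv (t (axis i 1))) (sorted_list_of_set S)) else 0)"
    unfolding outermorphism_def by (rule sum.cong) (auto simp: axis_def)
  then show ?thesis by simp
qed

lemma wedge_list_Cons: "wedge_list (X # Xs) = X \<and>\<^sub>m wedge_list Xs"
  by (simp add: wedge_list_def)

text \<open>Prepending the smallest index keeps the enumeration sorted, so both sides unfold to the
  same \<open>wedge_list\<close>.\<close>

lemma outermorphism_wedge_axis_less:
  assumes "\<And>j. j \<in> S \<Longrightarrow> i < j"
  shows "outermorphism t (vector_mv (axis i 1) \<and>\<^sub>m axis S 1) =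
    vector_mv (t (axis i 1)) \<and>\<^sub>m outermorphism t (axis S 1)"
proof -
  have "sorted_list_of_set (insert i S) = i # sorted_list_of_set S"
    using sorted_list_of_set.idem_if_sorted_distinct[of "i # sorted_list_of_set S"]
      assms less_irrefl[of i]
    by (fastforce simp: less_imp_le simp del: sorted_list_of_set.sorted_key_list_of_set_insert_remove)
  then show ?thesis
    by (simp add: vector_mv_axis wedge_axis_singleton assms outermorphism_axis wedge_list_Cons)
qed

text \<open>Insertion sort: \<open>axis i 1\<close> moves past the smaller indices, and the sign
  this costs also arises from anticommuting the images under \<open>t\<close>. Sorted lists stand
  for sets to allow induction.\<close>

lemma outermorphism_wedge_axis:
  "outermorphism t (vector_mv (axis i 1) \<and>\<^sub>m axis (set xs) 1) =
     vector_mv (t (axis i 1)) \<and>\<^sub>m outermorphism t (axis (set xs) 1)"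
  if "sorted_wrt (<) xs"
  using that
proof (induction xs)
  case Nil
  then show ?case using outermorphism_wedge_axis_less[of "{}" i t] by simp
next
  case (Cons j xs)
  let ?e = "\<lambda>i. vector_mv (axis i 1)" and ?te = "\<lambda>i. vector_mv (t (axis i 1))"
  have j: "j < l" if "l \<in> set xs" for l using Cons.prems that by auto
  have jxs: "axis (set (j # xs)) 1 = ?e j \<and>\<^sub>m axis (set xs) 1"
    by (simp add: vector_mv_axis wedge_axis_singleton j)
  consider "i < j" | "i = j" | "j < i" by fastforce
  then show ?case
  proof cases
    case 1
    then show ?thesis using j by (intro outermorphism_wedge_axis_less) (auto intro: less_trans)
  next
    case 2
    then show ?thesis unfolding jxs using outermorphism_wedge_axis_less[of "set xs" j t] j
      by (simp add: wedge_vector_square linear_0[OF linear_outermorphism])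
  next
    case 3
    \<comment> \<open>Either \<open>i\<close> already occurs and \<open>c = 0\<close>, or
      \<open>c\<close> is a sign. In both cases \<open>j\<close> lies below every index of the blade
      on the right, so the previous lemma applies to \<open>j\<close>.\<close>
    obtain c where c: "?e i \<and>\<^sub>m axis (set xs) 1 = c *\<^sub>R axis (insert i (set xs)) 1"
      by (cases "i \<in> set xs") (auto simp: wedge_vector_axis intro: that[of 0])
    have "outermorphism t (?e i \<and>\<^sub>m axis (set (j # xs)) 1) =
        - outermorphism t (?e j \<and>\<^sub>m ?e i \<and>\<^sub>m axis (set xs) 1)"
      unfolding jxs by (simp add: wedge_anticommute[of "axis i 1"] linear_neg[OF linear_outermorphism])
    also have "\<dots> = - (?te j \<and>\<^sub>m outermorphism t (?e i \<and>\<^sub>m axis (set xs) 1))"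
      using 3 j outermorphism_wedge_axis_less[of "insert i (set xs)" j t]
      by (auto simp: c wedge_simps linear_cmul[OF linear_outermorphism])
    also have "\<dots> = ?te i \<and>\<^sub>m ?te j \<and>\<^sub>m outermorphism t (axis (set xs) 1)"
      using Cons by (simp add: wedge_anticommute[of "t (axis i 1)"])
    also have "\<dots> = ?te i \<and>\<^sub>m outermorphism t (axis (set (j # xs)) 1)"
      unfolding jxs using outermorphism_wedge_axis_less[of "set xs" j t] j by simp
    finally show ?thesis .
  qed
qed

text \<open>Linearity of \<open>t\<close> extends the case of basis vectors to all \<open>v\<close>.
  With \<open>outermorphism_scalar\<close> this is the homomorphism property in the form used
  below.\<close>

lemma outermorphism_wedge:
  assumes "linear t"
  shows "outermorphism t (vector_mv v \<and>\<^sub>m X) = vector_mv (t v) \<and>\<^sub>m outermorphism t X"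
proof -
  note simps = vector_mv_simps wedge_simps linear_add[OF assms] linear_cmul[OF assms]
    linear_add[OF linear_outermorphism] linear_cmul[OF linear_outermorphism]
  have 1: "outermorphism t (vector_mv (axis i 1) \<and>\<^sub>m axis S 1) =
      vector_mv (t (axis i 1)) \<and>\<^sub>m outermorphism t (axis S 1)" for i S
    using outermorphism_wedge_axis[where xs = "sorted_list_of_set S"] by simp
  have 2: "outermorphism t (vector_mv (axis i 1) \<and>\<^sub>m X) =
      vector_mv (t (axis i 1)) \<and>\<^sub>m outermorphism t X" for i
    by (rule linear_eq_on_axis[where x = X], (auto intro!: linearI simp: simps)[2]) (rule 1)
  show ?thesis
    by (rule linear_eq_on_axis[where x = v], (auto intro!: linearI simp: simps)[2]) (rule 2)
qed

lemma outermorphism_scalar: "outermorphism t (scalar_mv r) = scalar_mv r"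
proof -
  show ?thesis
    unfolding scalar_mv_eq[of r] linear_cmul[OF linear_outermorphism]
    by (simp add: outermorphism_axis wedge_list_def scalar_mv_def)
qed

lemma outermorphism_vector:
  assumes "linear t"
  shows "outermorphism t (vector_mv v) = vector_mv (t v)"
  using outermorphism_wedge[OF assms, of v "scalar_mv 1"]
  by (simp add: outermorphism_scalar flip: vector_mv_eq_wedge)

text \<open>Both sides are linear in \<open>X\<close>, and on a blade \<open>s\<close> passes
  through the product one factor at a time.\<close>

lemma outermorphism_comp:
  assumes "linear s"
  shows "outermorphism s (outermorphism t X) = outermorphism (s \<circ> t) X"
proof -
  have "outermorphism s (wedge_list (map (\<lambda>i. vector_mv (f i)) xs)) = wedge_list (map (\<lambda>i. vector_mv (s (f i))) xs)"
    for f :: "'a \<Rightarrow> 'a canonical" and xs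
    by (induction xs) (simp_all add: wedge_list_def outermorphism_scalar outermorphism_wedge[OF assms])
  then show ?thesis
    by (intro linear_eq_on_axis[OF linear_compose[OF linear_outermorphism linear_outermorphism, unfolded o_def]
          linear_outermorphism, where x = X])
       (simp add: outermorphism_axis)
qed

lemma outermorphism_ident: "outermorphism (\<lambda>v. v) X = X"
  by (rule linear_eq_on_axis[OF linear_outermorphism linear_ident, where x = X])
     (simp only: outermorphism_axis wedge_basis_eq_axis)

lemma outermorphism_inverse:
  assumes "linear s" "\<And>v. s (t v) = v"
  shows "outermorphism s (outermorphism t X) = X"
proof -
  have "s \<circ> t = (\<lambda>v. v)" using assms(2) by auto
  then show ?thesis by (simp add: outermorphism_comp[OF assms(1)] outermorphism_ident)
qed


section \<open>Smooth maps and directional derivatives on a chart domain\<close>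

lemma linear_blinfun: "linear (blinfun_apply t)"
  by (rule bounded_linear.linear[OF blinfun.bounded_linear_right])

locale chart_domain =
  fixes A :: "('m::topological_space, 'n::{finite,linorder}) chart set"
    and U\<^sub>o U :: "'m set" and \<phi> :: "'m \<Rightarrow> 'n canonical"
  assumes atlas: "smooth_atlas A"
    and chart: "(U\<^sub>o, \<phi>) \<in> A"
    and open_U: "open U"
    and U_subset: "U \<subseteq> U\<^sub>o"
begin

lemma open_chart_image:
  assumes "(V, \<psi>) \<in> A"
  shows "open (\<psi> ` (U \<inter> V))"
proof -
  obtain \<psi>' where V: "open V" "open (\<psi> ` V)" and hom: "homeomorphism V (\<psi> ` V) \<psi> \<psi>'"
    using atlas assms by (fastforce simp: smooth_atlas_def is_chart_def)
  have "openin (top_of_set (\<psi> ` V)) (\<psi> ` (U \<inter> V))"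
    using homeomorphism_imp_open_map[OF hom, of "U \<inter> V"] open_U V(1)
    by (simp add: openin_open_eq open_Int)
  then show ?thesis using V(2) openin_open_trans by blast
qed

lemma chart_inj_on:
  assumes "(V, \<psi>) \<in> A"
  shows "inj_on \<psi> V"
proof -
  obtain \<psi>' where "homeomorphism V (\<psi> ` V) \<psi> \<psi>'"
    using atlas assms by (fastforce simp: smooth_atlas_def is_chart_def)
  then show ?thesis by (metis homeomorphism_def inj_on_inverseI)
qed

lemma chart_inv_into:
  assumes "(V, \<psi>) \<in> A" "y \<in> \<psi> ` (U \<inter> V)"
  shows "inv_into V \<psi> y \<in> U \<inter> V"
  using chart_inj_on[OF assms(1)] assms(2) by (auto simp: inv_into_f_f)

lemma smooth_mapD:
  "smooth_map A U f \<Longrightarrow> (V, \<psi>) \<in> A \<Longrightarrow> Ck_on k (\<psi> ` (U \<inter> V)) (\<lambda>y. f (inv_into V \<psi> y))"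
  by (fastforce simp: smooth_map_def smooth_on_def o_def)

lemma smooth_mapI:
  "(\<And>V \<psi> k. (V, \<psi>) \<in> A \<Longrightarrow> Ck_on k (\<psi> ` (U \<inter> V)) (\<lambda>y. f (inv_into V \<psi> y))) \<Longrightarrow> smooth_map A U f"
  by (auto simp: smooth_map_def smooth_on_def o_def)

text \<open>Fields are \<open>undefined\<close> off \<open>U\<close>; this allows their smoothness
  to be checked on unrestricted expressions.\<close>

lemma smooth_map_cong:
  fixes f g :: "'m \<Rightarrow> 'b::real_normed_vector"
  assumes "\<And>p. p \<in> U \<Longrightarrow> f p = g p"
  shows "smooth_map A U f \<longleftrightarrow> smooth_map A U g"
proof -
  have "smooth_map A U g" if "smooth_map A U f" "\<And>p. p \<in> U \<Longrightarrow> f p = g p"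
    for f g :: "'m \<Rightarrow> 'b"
  proof (rule smooth_mapI)
    fix V \<psi> k assume V: "(V, \<psi>) \<in> A"
    show "Ck_on k (\<psi> ` (U \<inter> V)) (\<lambda>y. g (inv_into V \<psi> y))"
      using Ck_on_cong[OF open_chart_image[OF V], of "\<lambda>y. f (inv_into V \<psi> y)" "\<lambda>y. g (inv_into V \<psi> y)" k]
        smooth_mapD[OF that(1) V, of k] chart_inv_into[OF V] that(2) by fastforce
  qed
  from this[of f g] this[of g f] assms show ?thesis by auto
qed

lemma smooth_map_const: "smooth_map A U (\<lambda>p. c)"
  by (intro smooth_mapI Ck_on_const open_chart_image)

lemma smooth_map_linear:
  "bounded_linear L \<Longrightarrow> smooth_map A U f \<Longrightarrow> smooth_map A U (\<lambda>p. L (f p))"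
  by (rule smooth_mapI, rule Ck_on_linear) (auto intro: open_chart_image smooth_mapD)

lemma smooth_map_bilinear:
  "bounded_bilinear B \<Longrightarrow> smooth_map A U f \<Longrightarrow> smooth_map A U g \<Longrightarrow> smooth_map A U (\<lambda>p. B (f p) (g p))"
  by (rule smooth_mapI, rule Ck_on_bilinear) (auto intro: open_chart_image smooth_mapD)

lemma smooth_map_sum:
  "(\<And>i. i \<in> I \<Longrightarrow> smooth_map A U (f i)) \<Longrightarrow> smooth_map A U (\<lambda>p. \<Sum>i\<in>I. f i p)"
  by (rule smooth_mapI, rule Ck_on_sum) (auto intro: open_chart_image smooth_mapD)

lemma smooth_map_prod:
  fixes f :: "'i \<Rightarrow> 'm \<Rightarrow> real"
  shows "(\<And>i. i \<in> I \<Longrightarrow> smooth_map A U (f i)) \<Longrightarrow> smooth_map A U (\<lambda>p. \<Prod>i\<in>I. f i p)"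
  by (induction I rule: infinite_finite_induct)
     (auto intro: smooth_map_const smooth_map_bilinear[OF bounded_bilinear_mult])

lemma smooth_map_diff:
  assumes "smooth_map A U f" "smooth_map A U g"
  shows "smooth_map A U (\<lambda>p. f p - g p)"
proof -
  have "smooth_map A U (\<lambda>p. - g p)"
    by (rule smooth_map_linear[OF bounded_linear_minus[OF bounded_linear_ident] assms(2)])
  with assms(1) have "smooth_map A U (\<lambda>p. \<Sum>i\<in>UNIV. (if i then f else (\<lambda>p. - g p)) p)"
    by (intro smooth_map_sum) simp
  then show ?thesis by (simp add: UNIV_bool)
qed

lemma smooth_map_inverse:
  fixes f :: "'m \<Rightarrow> real"
  assumes "smooth_map A U f" "\<And>p. p \<in> U \<Longrightarrow> f p \<noteq> 0"
  shows "smooth_map A U (\<lambda>p. inverse (f p))"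
proof (rule smooth_mapI, rule Ck_on_inverse)
  fix V \<psi> k y assume "(V, \<psi>) \<in> A" "y \<in> \<psi> ` (U \<inter> V)"
  then show "f (inv_into V \<psi> y) \<noteq> 0" using assms(2) chart_inv_into by blast
qed (auto intro: open_chart_image smooth_mapD assms(1))

lemma smooth_map_vec_nth: "smooth_map A U f \<Longrightarrow> smooth_map A U (\<lambda>p. f p $ i)"
  by (rule smooth_map_linear[OF bounded_linear_vec_nth])

lemma smooth_map_apply: "smooth_map A U f \<Longrightarrow> smooth_map A U (\<lambda>p. blinfun_apply (f p) v)"
  by (rule smooth_map_linear[OF blinfun.bounded_linear_left])

lemma smooth_map_vec:
  fixes f :: "'m \<Rightarrow> real ^ 'k"
  assumes "\<And>i. smooth_map A U (\<lambda>p. f p $ i)"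
  shows "smooth_map A U f"
proof -
  have "smooth_map A U (\<lambda>p. \<Sum>i\<in>UNIV. (f p $ i) *\<^sub>R (axis i 1 :: real ^ 'k))"
    by (intro smooth_map_sum smooth_map_bilinear[OF bounded_bilinear_scaleR] smooth_map_const assms)
  then show ?thesis by (simp only: axis_unit_sum)
qed

lemma smooth_map_blinfun:
  fixes f :: "'m \<Rightarrow> (real ^ 'k) \<Rightarrow>\<^sub>L 'b::real_normed_vector"
  assumes "\<And>i. smooth_map A U (\<lambda>p. blinfun_apply (f p) (axis i 1))"
  shows "smooth_map A U f"
proof -
  \<comment> \<open>A linear map is the sum of the rank-one maps that send \<open>x\<close> to
    \<open>x $ i\<close> times its value at \<open>axis i 1\<close>; these depend linearly on that
    value.\<close>
  have f: "f = (\<lambda>p. \<Sum>i\<in>UNIV.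
      blinfun_scaleR_left (blinfun_apply (f p) (axis i 1)) o\<^sub>L blinfun_inner_left (axis i 1))"
  proof (intro ext blinfun_eqI)
    fix p x
    show "blinfun_apply (f p) x = blinfun_apply (\<Sum>i\<in>UNIV.
        blinfun_scaleR_left (blinfun_apply (f p) (axis i 1)) o\<^sub>L blinfun_inner_left (axis i 1)) x"
      using linear_axis_sum[OF linear_blinfun, of "f p" x]
      by (simp add: blinfun.sum_left inner_axis)
  qed
  show ?thesis
    by (subst f)
       (intro smooth_map_sum smooth_map_bilinear[OF bounded_bilinear_blinfun_compose]
        smooth_map_const smooth_map_linear[OF bounded_linear_blinfun_scaleR_left] assms)
qed

lemma smooth_map_det:
  fixes M :: "'m \<Rightarrow> real ^ 'k ^ 'k"
  assumes "\<And>i j. smooth_map A U (\<lambda>p. M p $ i $ j)"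
  shows "smooth_map A U (\<lambda>p. det (M p))"
  unfolding det_def
  by (intro smooth_map_sum smooth_map_bilinear[OF bounded_bilinear_mult] smooth_map_const smooth_map_prod assms)

text \<open>The pointwise inverse is smooth because its entries are rational functions of those of
  \<open>h\<close>, with the nonvanishing determinant as denominator.\<close>

lemma smooth_map_inv:
  fixes h :: "('m, 'n) extensor_field"
  assumes "smooth_map A U h" "\<And>p. p \<in> U \<Longrightarrow> det (matrix (blinfun_apply (h p))) \<noteq> 0"
  obtains k :: "('m, 'n) extensor_field"
  where "smooth_map A U k"
    and "\<And>p v. p \<in> U \<Longrightarrow> blinfun_apply (h p) (blinfun_apply (k p) v) = v"
    and "\<And>p v. p \<in> U \<Longrightarrow> blinfun_apply (k p) (blinfun_apply (h p) v) = v"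
proof -
  let ?M = "\<lambda>p. matrix (blinfun_apply (h p))"
  let ?k = "\<lambda>p. Blinfun (inv (blinfun_apply (h p)))"
  have inv: "blinfun_apply (?k p) = inv (blinfun_apply (h p))" "bij (blinfun_apply (h p))" if p: "p \<in> U" for p
  proof -
    obtain f where f: "linear f" "blinfun_apply (h p) \<circ> f = id" "f \<circ> blinfun_apply (h p) = id"
      using assms(2)[OF p] matrix_invertible[OF linear_blinfun[of "h p"]] invertible_det_nz by blast
    show "bij (blinfun_apply (h p))" using f o_bij by blast
    have "inv (blinfun_apply (h p)) = f" using f inv_unique_comp by blast
    then show "blinfun_apply (?k p) = inv (blinfun_apply (h p))"
      using f(1) by (simp add: bounded_linear_Blinfun_apply linear_conv_bounded_linear)
  qed
  have hk: "blinfun_apply (h p) (blinfun_apply (?k p) v) = v" if "p \<in> U" for p v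
    using inv[OF that] by (simp add: bij_is_surj surj_f_inv_f)
  have kh: "blinfun_apply (?k p) (blinfun_apply (h p) v) = v" if "p \<in> U" for p v
    using inv[OF that] by (simp add: bij_is_inj)
  have "smooth_map A U ?k"
  proof (intro smooth_map_blinfun smooth_map_vec)
    fix j i
    have M: "smooth_map A U (\<lambda>p. ?M p $ l $ m)" for l m
      unfolding matrix_def by (simp add: smooth_map_vec_nth smooth_map_apply assms(1))
    \<comment> \<open>Cramer's rule: component \<open>i\<close> of the inverse applied to the
      \<open>j\<close>-th basis vector is the determinant with column \<open>i\<close> replaced by
      that vector, divided by the determinant of \<open>?M p\<close>.\<close>
    let ?N = "\<lambda>p. \<chi> l m. if m = i then axis j 1 $ l else ?M p $ l $ m"
    have N: "smooth_map A U (\<lambda>p. ?N p $ l $ m)" for l m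
      by (cases "m = i") (simp_all add: M smooth_map_const)
    have smooth: "smooth_map A U (\<lambda>p. det (?N p) * inverse (det (?M p)))"
      using assms(2)
      by (intro smooth_map_bilinear[OF bounded_bilinear_mult] smooth_map_inverse smooth_map_det M N) auto
    have eq: "blinfun_apply (?k p) (axis j 1) $ i = det (?N p) * inverse (det (?M p))" if p: "p \<in> U" for p
    proof -
      have "?M p *v blinfun_apply (?k p) (axis j 1) = axis j 1"
        using hk[OF p] by (simp add: matrix_works linear_blinfun linear_matrix_vector_mul_eq)
      then have "blinfun_apply (?k p) (axis j 1) =
          (\<chi> i. det (\<chi> l m. if m = i then axis j 1 $ l else ?M p $ l $ m) / det (?M p))"
        using cramer[OF assms(2)[OF p]] by blast
      then show ?thesis by (simp add: divide_inverse)
    qed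
    show "smooth_map A U (\<lambda>p. blinfun_apply (?k p) (axis j 1) $ i)"
      by (rule smooth_map_cong[THEN iffD2, OF eq smooth])
  qed
  with hk kh that show thesis by blast
qed

section \<open>Directional derivatives in the chart coordinates\<close>

abbreviation dd :: "'n canonical \<Rightarrow> ('m \<Rightarrow> 'b::real_normed_vector) \<Rightarrow> 'm \<Rightarrow> 'b" where
  "dd \<equiv> dir_deriv (U\<^sub>o, \<phi>)"

abbreviation coord_rep :: "('m \<Rightarrow> 'b) \<Rightarrow> 'n canonical \<Rightarrow> 'b" where
  "coord_rep X \<equiv> (\<lambda>y. X (inv_into U\<^sub>o \<phi> y))"

text \<open>By the chain rule along coordinate lines, the partial derivatives are the values of
  \<open>X'\<close> on the axes. Rules for \<open>dd\<close> can then be read off from rules for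
  total derivatives.\<close>

lemma dir_deriv_eqI:
  assumes "(coord_rep X has_derivative X') (at (\<phi> p))"
  shows "dd a X p = X' a"
proof -
  have lin: "linear X'" using assms by (rule has_derivative_linear)
  have "coord_partial (U\<^sub>o, \<phi>) \<mu> X p = X' (axis \<mu> 1)" for \<mu>
  proof -
    have "((\<lambda>s. \<phi> p + s *\<^sub>R axis \<mu> 1) has_derivative (\<lambda>s. s *\<^sub>R axis \<mu> 1)) (at (0::real))"
      by (auto intro!: derivative_eq_intros)
    from diff_chain_at[OF this, of "coord_rep X" X'] assms
    have "((\<lambda>s. coord_rep X (\<phi> p + s *\<^sub>R axis \<mu> 1)) has_derivative (\<lambda>s. s *\<^sub>R X' (axis \<mu> 1))) (at 0)"
      by (simp add: o_def linear_cmul[OF lin])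
    then show ?thesis
      by (auto simp: coord_partial_def has_vector_derivative_def intro!: vector_derivative_at)
  qed
  then show ?thesis
    using linear_axis_sum[OF lin, of a] by (simp add: dir_deriv_def inner_axis)
qed

lemma chart_image: "\<phi> ` (U \<inter> U\<^sub>o) = \<phi> ` U" "p \<in> U \<Longrightarrow> inv_into U\<^sub>o \<phi> (\<phi> p) = p"
  using U_subset chart_inj_on[OF chart] by (auto simp: inv_into_f_f Int_absorb2)

lemma open_chart: "open (\<phi> ` U)"
  using open_chart_image[OF chart] by (simp add: chart_image)

lemma has_derivative_dir_deriv:
  assumes "smooth_map A U X" "p \<in> U"
  shows "(coord_rep X has_derivative (\<lambda>a. dd a X p)) (at (\<phi> p))"
proof -
  have "Ck_on (Suc 0) (\<phi> ` U) (coord_rep X)"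
    using smooth_mapD[OF assms(1) chart] by (simp add: chart_image del: Ck_on.simps)
  then have *: "(coord_rep X has_derivative frechet_derivative (coord_rep X) (at (\<phi> p))) (at (\<phi> p))"
    using assms(2) open_chart by (intro has_frechet_derivative_on) auto
  then have "frechet_derivative (coord_rep X) (at (\<phi> p)) = (\<lambda>a. dd a X p)"
    using dir_deriv_eqI[OF *] by auto
  with * show ?thesis by simp
qed

text \<open>Seen in a chart \<psi>, this is a directional derivative taken in \<phi>, composed with
  the transition map from \<psi> to \<phi>. The former is of order \<open>k\<close> because
  \<open>X\<close> is of order \<open>k + 1\<close> in \<phi>, and the latter is smooth by the atlas
  condition.\<close>

lemma smooth_map_dir_deriv:
  assumes "smooth_map A U X"
  shows "smooth_map A U (dd a X)"
proof (rule smooth_mapI)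
  fix V \<psi> k assume V: "(V, \<psi>) \<in> A"
  let ?F = "\<lambda>x. frechet_derivative (coord_rep X) (at x) a" and ?\<tau> = "\<phi> \<circ> inv_into V \<psi>"
  have "Ck_on (Suc k) (\<phi> ` U) (coord_rep X)"
    using smooth_mapD[OF assms chart, of "Suc k"] by (simp only: chart_image)
  then have F: "Ck_on k (\<phi> ` U) ?F" by simp
  have "smooth_on (\<psi> ` (V \<inter> U\<^sub>o)) ?\<tau>"
    using atlas V chart by (fastforce simp: smooth_atlas_def)
  then have "Ck_on k (\<psi> ` (U \<inter> V)) ?\<tau>"
    using U_subset by (auto simp: smooth_on_def intro: Ck_on_subset)
  moreover have sub: "?\<tau> ` \<psi> ` (U \<inter> V) \<subseteq> \<phi> ` U"
    using chart_inv_into[OF V] by auto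
  ultimately have "Ck_on k (\<psi> ` (U \<inter> V)) (?F \<circ> ?\<tau>)"
    using F open_chart_image[OF V] open_chart by (intro Ck_on_compose) auto
  moreover have "(?F \<circ> ?\<tau>) y = dd a X (inv_into V \<psi> y)" if "y \<in> \<psi> ` (U \<inter> V)" for y
    using frechet_derivativeI[OF has_derivative_dir_deriv[OF assms]] chart_inv_into[OF V that] by simp
  ultimately show "Ck_on k (\<psi> ` (U \<inter> V)) (\<lambda>y. dd a X (inv_into V \<psi> y))"
    using Ck_on_cong[OF open_chart_image[OF V], of "?F \<circ> ?\<tau>" "\<lambda>y. dd a X (inv_into V \<psi> y)" k] by simp
qed

lemma dir_deriv_cong:
  assumes "\<And>q. q \<in> U \<Longrightarrow> X q = Y q" "smooth_map A U Y" "p \<in> U"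
  shows "dd a X p = dd a Y p"
proof (rule dir_deriv_eqI)
  show "(coord_rep X has_derivative (\<lambda>a. dd a Y p)) (at (\<phi> p))"
  proof (subst has_derivative_cong_open[OF open_chart])
    fix y assume "y \<in> \<phi> ` U"
    then show "coord_rep X y = coord_rep Y y" using assms(1) by (auto simp: chart_image)
  qed (use assms(3) has_derivative_dir_deriv[OF assms(2,3)] in auto)
qed

lemma dir_deriv_const: "dd a (\<lambda>p. c) p = 0"
  by (rule dir_deriv_eqI) (rule has_derivative_const)

lemma dir_deriv_linear:
  assumes "bounded_linear L" "smooth_map A U X" "p \<in> U"
  shows "dd a (\<lambda>q. L (X q)) p = L (dd a X p)"
  by (rule dir_deriv_eqI) (rule bounded_linear.has_derivative[OF assms(1) has_derivative_dir_deriv[OF assms(2,3)]])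

lemma dir_deriv_bilinear:
  assumes "bounded_bilinear B" "smooth_map A U X" "smooth_map A U Y" "p \<in> U"
  shows "dd a (\<lambda>q. B (X q) (Y q)) p = B (X p) (dd a Y p) + B (dd a X p) (Y p)"
  using dir_deriv_eqI[OF bounded_bilinear.FDERIV[OF assms(1) has_derivative_dir_deriv[OF assms(2,4)]
        has_derivative_dir_deriv[OF assms(3,4)]], of a] assms(4)
  by (simp add: chart_image)

lemma dir_deriv_sum:
  assumes "\<And>i. i \<in> I \<Longrightarrow> smooth_map A U (X i)" "p \<in> U"
  shows "dd a (\<lambda>q. \<Sum>i\<in>I. X i q) p = (\<Sum>i\<in>I. dd a (X i) p)"
  by (rule dir_deriv_eqI) (intro has_derivative_sum has_derivative_dir_deriv assms)

lemma dir_deriv_apply: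
  assumes "smooth_map A U t" "p \<in> U"
  shows "dd a (\<lambda>q. blinfun_apply (t q) v) p = blinfun_apply (dd a t p) v"
  by (rule dir_deriv_linear[OF blinfun.bounded_linear_left assms])

lemma linear_dir_deriv: "linear (\<lambda>a. dd a X p)"
  by (rule linearI) (simp_all add: dir_deriv_def inner_add_left scaleR_add_left sum.distrib scaleR_sum_right)


section \<open>Outermorphisms intertwine covariant derivatives\<close>

lemma smooth_map_outermorphism:
  fixes t :: "('m, 'n) extensor_field"
  assumes "smooth_map A U t" "smooth_map A U X"
  shows "smooth_map A U (\<lambda>q. outermorphism (blinfun_apply (t q)) (X q))"
proof -
  have "smooth_map A U (\<lambda>q. wedge_list (map (\<lambda>i. vector_mv (blinfun_apply (t q) (axis i 1))) xs))" for xs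
    by (induction xs)
       (auto simp: wedge_list_def intro!: smooth_map_const smooth_map_bilinear[OF bounded_bilinear_wedge]
         smooth_map_linear[OF bounded_linear_vector_mv] smooth_map_apply assms(1))
  then show ?thesis
    unfolding outermorphism_def
    by (intro smooth_map_sum smooth_map_bilinear[OF bounded_bilinear_scaleR] smooth_map_vec_nth assms(2))
qed

text \<open>Both sides obey the same Leibniz rule under exterior multiplication by a vector:
  \<open>vec\<close> settles the new factor, and on scalars both derivations vanish. This gives the
  claim on blades, hence in general.\<close>

lemma outermorphism_intertwine:
  fixes t :: "('m, 'n) extensor_field"
  assumes t: "smooth_map A U t" and X: "smooth_map A U X" and p: "p \<in> U"
    and G: "linear G" and G': "linear G'"
    and vec: "\<And>v. blinfun_apply (t p) (G v) = dd a (\<lambda>q. blinfun_apply (t q) v) p + G' (blinfun_apply (t p) v)"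
  shows "outermorphism (blinfun_apply (t p)) (dd a X p + derivation_ext G (X p)) =
    dd a (\<lambda>q. outermorphism (blinfun_apply (t q)) (X q)) p +
    derivation_ext G' (outermorphism (blinfun_apply (t p)) (X p))"
proof -
  let ?T = "\<lambda>q. outermorphism (blinfun_apply (t q))"
  have smooth: "smooth_map A U (\<lambda>q. ?T q Y)" for Y
    using smooth_map_outermorphism[OF t smooth_map_const[of Y]] .
  let ?e = "\<lambda>xs. wedge_list (map (\<lambda>i. vector_mv (axis i (1::real))) (xs :: 'n list))"
  \<comment> \<open>The product is a constant field, so only the outermorphism is differentiated.
    Lists in any order are allowed, which makes the induction immediate to set up.\<close>
  have list: "?T p (derivation_ext G (?e xs)) =
      dd a (\<lambda>q. ?T q (?e xs)) p + derivation_ext G' (?T p (?e xs))" for xs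
  proof (induction xs)
    case Nil
    then show ?case
      by (simp add: wedge_list_def outermorphism_scalar derivation_ext_scalar dir_deriv_const
          linear_0[OF linear_outermorphism])
  next
    case (Cons i xs)
    let ?v = "axis i 1 :: 'n canonical"
    have tv: "smooth_map A U (\<lambda>q. vector_mv (blinfun_apply (t q) ?v))"
      by (intro smooth_map_linear[OF bounded_linear_vector_mv] smooth_map_apply t)
    have "dd a (\<lambda>q. ?T q (?e (i # xs))) p =
        dd a (\<lambda>q. vector_mv (blinfun_apply (t q) ?v) \<and>\<^sub>m ?T q (?e xs)) p"
      by (simp add: wedge_list_Cons outermorphism_wedge[OF linear_blinfun])
    also have "\<dots> = vector_mv (blinfun_apply (t p) ?v) \<and>\<^sub>m dd a (\<lambda>q. ?T q (?e xs)) p +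
        vector_mv (dd a (\<lambda>q. blinfun_apply (t q) ?v) p) \<and>\<^sub>m ?T p (?e xs)"
      unfolding dir_deriv_bilinear[OF bounded_bilinear_wedge tv smooth p]
        dir_deriv_linear[OF bounded_linear_vector_mv smooth_map_apply[OF t] p] ..
    finally show ?case
      by (simp add: wedge_list_Cons derivation_ext_wedge[OF G] derivation_ext_wedge[OF G']
          outermorphism_wedge[OF linear_blinfun] linear_add[OF linear_outermorphism]
          Cons.IH vec vector_mv_simps wedge_simps)
  qed
  have blade: "?T p (derivation_ext G (axis S 1)) =
      dd a (\<lambda>q. ?T q (axis S 1)) p + derivation_ext G' (?T p (axis S 1))" for S
    using list[of "sorted_list_of_set S"] by (simp only: wedge_basis_eq_axis)
  have expand: "f (X p) = (\<Sum>S\<in>UNIV. (X p $ S) *\<^sub>R f (axis S 1))"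
    if "linear f" for f :: "'n multivector \<Rightarrow> 'n multivector"
    by (rule linear_axis_sum[OF that])
  \<comment> \<open>The coefficients of \<open>X\<close> and the images of the blades both vary with
    \<open>q\<close>; the derivatives of the coefficients recombine to
    \<open>?T p (dd a X p)\<close>.\<close>
  have "dd a (\<lambda>q. ?T q (X q)) p = dd a (\<lambda>q. \<Sum>S\<in>UNIV. (X q $ S) *\<^sub>R ?T q (axis S 1)) p"
    by (rule arg_cong[where f = "\<lambda>Z. dd a Z p"], rule ext, rule linear_axis_sum, rule linear_outermorphism)
  also have "\<dots> = (\<Sum>S\<in>UNIV. dd a (\<lambda>q. (X q $ S) *\<^sub>R ?T q (axis S 1)) p)"
    by (intro dir_deriv_sum p smooth_map_bilinear[OF bounded_bilinear_scaleR] smooth_map_vec_nth X smooth)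
  also have "\<dots> = (\<Sum>S\<in>UNIV. (X p $ S) *\<^sub>R dd a (\<lambda>q. ?T q (axis S 1)) p +
      (dd a X p $ S) *\<^sub>R ?T p (axis S 1))"
    by (simp add: dir_deriv_bilinear[OF bounded_bilinear_scaleR smooth_map_vec_nth[OF X] smooth p]
        dir_deriv_linear[OF bounded_linear_vec_nth X p])
  also have "\<dots> = (\<Sum>S\<in>UNIV. (X p $ S) *\<^sub>R dd a (\<lambda>q. ?T q (axis S 1)) p) + ?T p (dd a X p)"
    by (simp add: sum.distrib linear_axis_sum[OF linear_outermorphism, of _ "dd a X p"])
  finally have 1: "dd a (\<lambda>q. ?T q (X q)) p =
      (\<Sum>S\<in>UNIV. (X p $ S) *\<^sub>R dd a (\<lambda>q. ?T q (axis S 1)) p) + ?T p (dd a X p)" .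
  have 2: "?T p (derivation_ext G (X p)) = (\<Sum>S\<in>UNIV. (X p $ S) *\<^sub>R ?T p (derivation_ext G (axis S 1)))"
    by (rule expand) (rule linear_compose[OF linear_derivation_ext linear_outermorphism, unfolded o_def])
  have 3: "derivation_ext G' (?T p (X p)) = (\<Sum>S\<in>UNIV. (X p $ S) *\<^sub>R derivation_ext G' (?T p (axis S 1)))"
    by (rule expand) (rule linear_compose[OF linear_outermorphism linear_derivation_ext, unfolded o_def])
  show ?thesis
    unfolding linear_add[OF linear_outermorphism] 1 2 3 blade by (simp add: scaleR_add_right sum.distrib)
qed

end


section \<open>Gauge transformation of connections\<close>

text \<open>Names the two intertwining conditions of the theorem with the gauge field as a
  parameter, so that they can also be stated for its inverse.\<close>

definition gauge_related ::
  "('m, 'n::{finite,linorder}) chart set \<Rightarrow> 'm set \<Rightarrow> ('m, 'n) extensor_field \<Rightarrow>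
     ('m, 'n) operator \<times> ('m, 'n) operator \<Rightarrow> ('m, 'n) operator \<times> ('m, 'n) operator \<Rightarrow> bool" where
  "gauge_related A U h D E \<longleftrightarrow>
     (\<forall>a. \<forall>X\<in>multivector_fields A U.
        outer_ext U h (fst D a X) = fst E a (outer_ext U h X) \<and>
        outer_ext_star U h (snd D a X) = snd E a (outer_ext_star U h X))"

lemma conn_ext_eq_derivation_ext: "conn_ext \<gamma> a = derivation_ext (blinfun_apply (blinfun_apply \<gamma> a))"
  by (simp add: fun_eq_iff conn_ext_def derivation_ext_def)

lemma derivation_ext_uminus: "derivation_ext (\<lambda>v. - G v) X = - derivation_ext G X"
  by (simp add: derivation_ext_def vector_mv_simps wedge_simps sum_negf)

text \<open>The inverse \<open>k\<close> is a parameter, so that the assumptions are symmetric in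
  \<open>h\<close> and \<open>k\<close> and every result is also available for the inverse
  field.\<close>

locale gauge = chart_domain A U\<^sub>o U \<phi>
  for A :: "('m::topological_space, 'n::{finite,linorder}) chart set"
    and U\<^sub>o U :: "'m set" and \<phi> :: "'m \<Rightarrow> 'n canonical" +
  fixes h k :: "('m, 'n) extensor_field"
  assumes smooth_h: "smooth_map A U h" and smooth_k: "smooth_map A U k"
    and hk: "\<And>p v. p \<in> U \<Longrightarrow> blinfun_apply (h p) (blinfun_apply (k p) v) = v"
    and kh: "\<And>p v. p \<in> U \<Longrightarrow> blinfun_apply (k p) (blinfun_apply (h p) v) = v"
begin

lemma gauge_sym: "gauge A U\<^sub>o U \<phi> k h"
  by unfold_locales (simp_all add: smooth_h smooth_k hk kh)

text \<open>On \<open>U\<close> this is the inverse adjoint of \<open>h\<close>, made an extensor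
  field in its own right so that \<open>outer_ext_star\<close> becomes an instance of
  \<open>outer_ext\<close>.\<close>

definition h_star :: "('m, 'n) extensor_field" where
  "h_star p = Blinfun (adjoint (blinfun_apply (k p)))"

lemma h_star_apply: "blinfun_apply (h_star p) = adjoint (blinfun_apply (k p))"
  unfolding h_star_def
  by (rule bounded_linear_Blinfun_apply)
     (simp add: adjoint_linear linear_blinfun flip: linear_conv_bounded_linear)

lemma h_star_inner: "blinfun_apply (h_star p) v \<bullet> w = v \<bullet> blinfun_apply (k p) w"
  using adjoint_works[OF linear_blinfun, of w "k p" v] by (simp add: h_star_apply inner_commute)

lemma inv_h: "p \<in> U \<Longrightarrow> inv (blinfun_apply (h p)) = blinfun_apply (k p)"
  by (rule inv_equality) (simp_all add: hk kh)

lemma smooth_h_star: "smooth_map A U h_star"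
proof (intro smooth_map_blinfun smooth_map_vec)
  fix i j
  have "blinfun_apply (h_star p) (axis i 1) $ j = blinfun_apply (k p) (axis j 1) $ i" for p
    using h_star_inner[of p "axis i 1" "axis j 1"] by (simp add: inner_axis inner_axis')
  then show "smooth_map A U (\<lambda>p. blinfun_apply (h_star p) (axis i 1) $ j)"
    by (simp add: smooth_map_vec_nth smooth_map_apply smooth_k)
qed

section \<open>Bijectivity on multivector fields and uniqueness of related pairs\<close>

lemma outer_ext_star_eq: "outer_ext_star U h X = outer_ext U h_star X"
  by (simp add: outer_ext_star_def outer_ext_def h_star_apply inv_h fun_eq_iff restrict_def)

lemma outer_ext_in_fields:
  fixes t :: "('m, 'n) extensor_field"
  assumes "smooth_map A U t" "X \<in> multivector_fields A U"
  shows "outer_ext U t X \<in> multivector_fields A U"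
proof -
  have "smooth_map A U (\<lambda>q. outermorphism (blinfun_apply (t q)) (X q))"
    using assms by (intro smooth_map_outermorphism) (auto simp: smooth_fields_def)
  then show ?thesis
    using smooth_map_cong[of "outer_ext U t X" "\<lambda>q. outermorphism (blinfun_apply (t q)) (X q)"]
    by (auto simp: smooth_fields_def outer_ext_def)
qed

lemma outer_ext_inverse:
  fixes s t :: "('m, 'n) extensor_field"
  assumes "\<And>p v. p \<in> U \<Longrightarrow> blinfun_apply (s p) (blinfun_apply (t p) v) = v" "X \<in> extensional U"
  shows "outer_ext U s (outer_ext U t X) = X"
proof
  fix p
  show "outer_ext U s (outer_ext U t X) p = X p"
    by (cases "p \<in> U")
       (simp_all add: outer_ext_def outermorphism_inverse[OF linear_blinfun assms(1)] extensional_arb[OF assms(2)])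
qed

lemma star_inverse:
  assumes "p \<in> U"
  shows "adjoint (blinfun_apply (k p)) (adjoint (blinfun_apply (h p)) v) = v"
    and "adjoint (blinfun_apply (h p)) (adjoint (blinfun_apply (k p)) v) = v"
  by (rule vector_eq_ldot[THEN iffD1], simp add: adjoint_works[OF linear_blinfun] hk kh assms)+

text \<open>Preimages come from the inverse fields: \<open>k\<close> undoes \<open>h\<close>, and
  the adjoint of \<open>h\<close> undoes \<open>h_star\<close>.\<close>

lemma fields_surj:
  assumes "Y \<in> multivector_fields A U"
  obtains X Z where "X \<in> multivector_fields A U" "outer_ext U h X = Y"
    and "Z \<in> multivector_fields A U" "outer_ext_star U h Z = Y"
proof -
  interpret i: gauge A U\<^sub>o U \<phi> k h by (rule gauge_sym)
  have ext: "Y \<in> extensional U" using assms by (simp add: smooth_fields_def)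
  have "outer_ext U h (outer_ext U k Y) = Y"
    using ext by (intro outer_ext_inverse) (simp_all add: hk)
  moreover have "outer_ext_star U h (outer_ext U i.h_star Y) = Y"
    unfolding outer_ext_star_eq
    using ext by (intro outer_ext_inverse) (simp_all add: h_star_apply i.h_star_apply star_inverse)
  ultimately show thesis
    using that outer_ext_in_fields[OF smooth_k assms] outer_ext_in_fields[OF i.smooth_h_star assms] by blast
qed

lemma cov_deriv_pair_undefined:
  assumes "cov_deriv_pair A c U E" "X \<notin> multivector_fields A U"
  shows "fst E a X = undefined" "snd E a X = undefined"
  using assms by (auto simp: cov_deriv_pair_def cov_plus_def cov_minus_def)

lemma cov_deriv_pair_extensional:
  assumes "cov_deriv_pair A c U E" "X \<in> multivector_fields A U"
  shows "fst E a X \<in> extensional U" "snd E a X \<in> extensional U"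
  using assms by (auto simp: cov_deriv_pair_def cov_plus_def cov_minus_def)

text \<open>By surjectivity the relation prescribes the values on all fields; on all other arguments
  the operators are \<open>undefined\<close>.\<close>

lemma gauge_related_unique:
  assumes "cov_deriv_pair A c U E" "cov_deriv_pair A c U E'"
    and "gauge_related A U h D E" "gauge_related A U h D E'"
  shows "E = E'"
proof -
  have "fst E a Y = fst E' a Y \<and> snd E a Y = snd E' a Y" for a Y
  proof (cases "Y \<in> multivector_fields A U")
    case True
    obtain X Z where "X \<in> multivector_fields A U" "outer_ext U h X = Y"
      and "Z \<in> multivector_fields A U" "outer_ext_star U h Z = Y"
      using fields_surj[OF True] .
    then show ?thesis using assms(3,4) unfolding gauge_related_def by metis
  next
    case False
    then show ?thesis
      using cov_deriv_pair_undefined[OF assms(1)] cov_deriv_pair_undefined[OF assms(2)] by simp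
  qed
  then show ?thesis by (simp add: prod_eq_iff fun_eq_iff)
qed

text \<open>Applying the inverse maps to the relation at the preimages of \<open>Y\<close> reverses
  it. This reduces the converse half of the theorem to the first half, with \<open>k\<close> in
  place of \<open>h\<close>.\<close>

lemma gauge_related_inverse:
  assumes D: "cov_deriv_pair A c U D" and rel: "gauge_related A U h D E"
  shows "gauge_related A U k E D"
  unfolding gauge_related_def
proof (intro allI ballI)
  interpret i: gauge A U\<^sub>o U \<phi> k h by (rule gauge_sym)
  fix a Y assume Y: "Y \<in> multivector_fields A U"
  obtain X Z where X: "X \<in> multivector_fields A U" "outer_ext U h X = Y"
    and Z: "Z \<in> multivector_fields A U" "outer_ext_star U h Z = Y"
    using fields_surj[OF Y] .
  have 1: "outer_ext U k (outer_ext U h W) = W" if "W \<in> extensional U" for W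
    using that by (intro outer_ext_inverse) (simp_all add: kh)
  have 2: "outer_ext_star U k (outer_ext_star U h W) = W" if "W \<in> extensional U" for W
    unfolding outer_ext_star_eq i.outer_ext_star_eq
    using that by (intro outer_ext_inverse) (simp_all add: h_star_apply i.h_star_apply star_inverse)
  have ext: "X \<in> extensional U" "Z \<in> extensional U"
    using X(1) Z(1) by (simp_all add: smooth_fields_def)
  have "fst E a Y = outer_ext U h (fst D a X)" "snd E a Y = outer_ext_star U h (snd D a Z)"
    using rel X Z unfolding gauge_related_def by auto
  note E = this
  have "outer_ext U k (fst E a Y) = fst D a (outer_ext U k Y)"
    unfolding E by (simp add: 1 cov_deriv_pair_extensional(1)[OF D X(1)] ext flip: X(2))
  moreover have "outer_ext_star U k (snd E a Y) = snd D a (outer_ext_star U k Y)"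
    unfolding E by (simp add: 2 cov_deriv_pair_extensional(2)[OF D Z(1)] ext flip: Z(2))
  ultimately show "outer_ext U k (fst E a Y) = fst D a (outer_ext U k Y) \<and>
      outer_ext_star U k (snd E a Y) = snd D a (outer_ext_star U k Y)" ..
qed

text \<open>Obtained by solving the intertwining condition on grade 1 for the new connection;
  \<open>dd a h p\<close> is the derivative of \<open>h\<close> as an operator-valued map.\<close>

definition gauge_connection :: "('m, 'n) connection \<Rightarrow> ('m, 'n) connection" where
  "gauge_connection \<gamma> p = Blinfun (\<lambda>a. (h p o\<^sub>L blinfun_apply (\<gamma> p) a o\<^sub>L k p) - (dd a h p o\<^sub>L k p))"

lemma gauge_connection_apply:
  "blinfun_apply (gauge_connection \<gamma> p) a = (h p o\<^sub>L blinfun_apply (\<gamma> p) a o\<^sub>L k p) - (dd a h p o\<^sub>L k p)"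
proof -
  have "linear (\<lambda>a. (h p o\<^sub>L blinfun_apply (\<gamma> p) a o\<^sub>L k p) - (dd a h p o\<^sub>L k p))"
    by (rule linearI)
       (auto intro!: blinfun_eqI simp: linear_add[OF linear_dir_deriv] linear_cmul[OF linear_dir_deriv]
         blinfun.bilinear_simps algebra_simps)
  then show ?thesis
    by (simp add: gauge_connection_def bounded_linear_Blinfun_apply linear_conv_bounded_linear)
qed

lemma smooth_gauge_connection:
  assumes "smooth_map A U \<gamma>"
  shows "smooth_map A U (gauge_connection \<gamma>)"
  by (rule smooth_map_blinfun, unfold gauge_connection_apply)
     (intro smooth_map_diff smooth_map_bilinear[OF bounded_bilinear_blinfun_compose] smooth_h smooth_k
      smooth_map_apply smooth_map_dir_deriv assms)

text \<open>The hypothesis \<open>vec\<close> of \<open>outermorphism_intertwine\<close> for the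
  field \<open>h\<close>.\<close>

lemma gauge_connection_plus:
  assumes "p \<in> U"
  shows "blinfun_apply (h p) (blinfun_apply (blinfun_apply (\<gamma> p) a) v) =
    dd a (\<lambda>q. blinfun_apply (h q) v) p +
    blinfun_apply (blinfun_apply (gauge_connection \<gamma> p) a) (blinfun_apply (h p) v)"
  by (simp add: dir_deriv_apply[OF smooth_h assms] gauge_connection_apply blinfun.bilinear_simps kh assms)

text \<open>Obtained by differentiating the constant field \<open>h q (k q v) = v\<close> and
  applying \<open>k p\<close>.\<close>

lemma dir_deriv_inverse:
  assumes p: "p \<in> U"
  shows "blinfun_apply (dd a k p) v = - blinfun_apply (k p) (blinfun_apply (dd a h p) (blinfun_apply (k p) v))"
proof -
  have "dd a (\<lambda>q. blinfun_apply (h q) (blinfun_apply (k q) v)) p = dd a (\<lambda>q. v) p"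
    by (rule dir_deriv_cong) (simp_all add: hk smooth_map_const p)
  then have "blinfun_apply (h p) (blinfun_apply (dd a k p) v) +
      blinfun_apply (dd a h p) (blinfun_apply (k p) v) = 0"
    by (simp add: dir_deriv_bilinear[OF bounded_bilinear_blinfun_apply smooth_h smooth_map_apply[OF smooth_k] p]
        dir_deriv_apply[OF smooth_k p] dir_deriv_const)
  then have "blinfun_apply (h p) (blinfun_apply (dd a k p) v) =
      - blinfun_apply (dd a h p) (blinfun_apply (k p) v)"
    by (simp add: eq_neg_iff_add_eq_0)
  from arg_cong[OF this, of "blinfun_apply (k p)"] show ?thesis
    by (simp add: kh p blinfun.minus_right)
qed

text \<open>The hypothesis \<open>vec\<close> for \<open>h_star\<close> and the negative adjoints,
  with the same new connection. Tested against \<open>w\<close>, it becomes an identity about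
  \<open>k\<close> and its derivative.\<close>

lemma gauge_connection_minus:
  assumes p: "p \<in> U"
  shows "blinfun_apply (h_star p) (- adjoint (blinfun_apply (blinfun_apply (\<gamma> p) a)) v) =
    dd a (\<lambda>q. blinfun_apply (h_star q) v) p +
    - adjoint (blinfun_apply (blinfun_apply (gauge_connection \<gamma> p) a)) (blinfun_apply (h_star p) v)"
proof (rule vector_eq_rdot[THEN iffD1], intro allI)
  fix w
  let ?G = "blinfun_apply (blinfun_apply (\<gamma> p) a)"
  let ?G' = "blinfun_apply (blinfun_apply (gauge_connection \<gamma> p) a)"
  have adj: "adjoint (blinfun_apply B) x \<bullet> y = x \<bullet> blinfun_apply B y"
    for B :: "'n canonical \<Rightarrow>\<^sub>L 'n canonical" and x y
    using adjoint_works[OF linear_blinfun, of y B x] by (simp add: inner_commute)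
  have "dd a (\<lambda>q. blinfun_apply (h_star q) v) p \<bullet> w = dd a (\<lambda>q. blinfun_apply (h_star q) v \<bullet> w) p"
    by (rule dir_deriv_linear[OF bounded_linear_inner_left smooth_map_apply[OF smooth_h_star] p, symmetric])
  also have "\<dots> = v \<bullet> blinfun_apply (dd a k p) w"
    unfolding h_star_inner dir_deriv_linear[OF bounded_linear_inner_right smooth_map_apply[OF smooth_k] p]
      dir_deriv_apply[OF smooth_k p] ..
  finally have 1: "dd a (\<lambda>q. blinfun_apply (h_star q) v) p \<bullet> w = v \<bullet> blinfun_apply (dd a k p) w" .
  \<comment> \<open>Composing the new connection with \<open>k p\<close> on the left turns its
    second term into the derivative of \<open>k\<close>, by
    \<open>dir_deriv_inverse\<close>.\<close>
  have "blinfun_apply (k p) (?G' w) = ?G (blinfun_apply (k p) w) + blinfun_apply (dd a k p) w"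
    by (simp add: gauge_connection_apply blinfun.bilinear_simps kh p dir_deriv_inverse)
  then show "blinfun_apply (h_star p) (- adjoint ?G v) \<bullet> w =
      (dd a (\<lambda>q. blinfun_apply (h_star q) v) p + - adjoint ?G' (blinfun_apply (h_star p) v)) \<bullet> w"
    by (simp add: inner_add_left inner_diff_left 1 h_star_inner adj inner_add_right)
qed

lemma cov_plus_apply:
  "X \<in> multivector_fields A U \<Longrightarrow> p \<in> U \<Longrightarrow> cov_plus A (U\<^sub>o, \<phi>) U \<gamma> a X p =
    dd a X p + derivation_ext (blinfun_apply (blinfun_apply (\<gamma> p) a)) (X p)"
  by (simp add: cov_plus_def conn_ext_eq_derivation_ext)

text \<open>Since \<open>adjoint_derivation_ext\<close> yields a derivation again, the minus
  operator takes the form of a plus operator, and one intertwining lemma serves both.\<close>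

lemma cov_minus_apply:
  "X \<in> multivector_fields A U \<Longrightarrow> p \<in> U \<Longrightarrow> cov_minus A (U\<^sub>o, \<phi>) U \<gamma> a X p =
    dd a X p + derivation_ext (\<lambda>v. - adjoint (blinfun_apply (blinfun_apply (\<gamma> p) a)) v) (X p)"
  by (simp add: cov_minus_def conn_ext_eq_derivation_ext adjoint_derivation_ext[OF linear_blinfun]
      derivation_ext_uminus)

lemma dir_deriv_outer_ext:
  fixes t :: "('m, 'n) extensor_field"
  assumes "smooth_map A U t" "X \<in> multivector_fields A U" "p \<in> U"
  shows "dd a (outer_ext U t X) p = dd a (\<lambda>q. outermorphism (blinfun_apply (t q)) (X q)) p"
  using assms
  by (intro dir_deriv_cong smooth_map_outermorphism) (auto simp: outer_ext_def smooth_fields_def)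

text \<open>At points of \<open>U\<close> this is \<open>outermorphism_intertwine\<close> for
  \<open>h\<close> and for \<open>h_star\<close>; off \<open>U\<close> both sides are
  \<open>undefined\<close>.\<close>

lemma gauge_related_connection:
  "gauge_related A U h (cov_plus A (U\<^sub>o, \<phi>) U \<gamma>, cov_minus A (U\<^sub>o, \<phi>) U \<gamma>)
     (cov_plus A (U\<^sub>o, \<phi>) U (gauge_connection \<gamma>), cov_minus A (U\<^sub>o, \<phi>) U (gauge_connection \<gamma>))"
  unfolding gauge_related_def fst_conv snd_conv
proof (intro allI ballI conjI)
  fix a X assume X: "X \<in> multivector_fields A U"
  note fields = outer_ext_in_fields[OF smooth_h X] outer_ext_in_fields[OF smooth_h_star X]
  have smooth_X: "smooth_map A U X" using X by (simp add: smooth_fields_def)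
  have lin: "linear (\<lambda>v. - adjoint (blinfun_apply B) v)" for B :: "'n canonical \<Rightarrow>\<^sub>L 'n canonical"
    by (intro linear_compose_neg adjoint_linear linear_blinfun)
  let ?\<gamma>' = "gauge_connection \<gamma>"
  show "outer_ext U h (cov_plus A (U\<^sub>o, \<phi>) U \<gamma> a X) = cov_plus A (U\<^sub>o, \<phi>) U ?\<gamma>' a (outer_ext U h X)"
  proof
    fix p
    show "outer_ext U h (cov_plus A (U\<^sub>o, \<phi>) U \<gamma> a X) p = cov_plus A (U\<^sub>o, \<phi>) U ?\<gamma>' a (outer_ext U h X) p"
    proof (cases "p \<in> U")
      case True
      from outermorphism_intertwine[OF smooth_h smooth_X True linear_blinfun linear_blinfun
          gauge_connection_plus[OF True, of \<gamma> a]]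
      show ?thesis
        by (simp add: cov_plus_apply[OF X True] cov_plus_apply[OF fields(1) True]
            dir_deriv_outer_ext[OF smooth_h X True]) (simp add: outer_ext_def cov_plus_apply X True)
    qed (use fields in \<open>simp add: outer_ext_def cov_plus_def\<close>)
  qed
  show "outer_ext_star U h (cov_minus A (U\<^sub>o, \<phi>) U \<gamma> a X) =
      cov_minus A (U\<^sub>o, \<phi>) U ?\<gamma>' a (outer_ext_star U h X)"
    unfolding outer_ext_star_eq
  proof
    fix p
    show "outer_ext U h_star (cov_minus A (U\<^sub>o, \<phi>) U \<gamma> a X) p =
        cov_minus A (U\<^sub>o, \<phi>) U ?\<gamma>' a (outer_ext U h_star X) p"
    proof (cases "p \<in> U")
      case True
      from outermorphism_intertwine[OF smooth_h_star smooth_X True lin lin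
          gauge_connection_minus[OF True, of \<gamma> a]]
      show ?thesis
        by (simp add: cov_minus_apply[OF X True] cov_minus_apply[OF fields(2) True]
            dir_deriv_outer_ext[OF smooth_h_star X True]) (simp add: outer_ext_def cov_minus_apply X True)
    qed (use fields in \<open>simp add: outer_ext_def cov_minus_def\<close>)
  qed
qed

section \<open>Transfer of metric compatibility\<close>

lemma vector_mv_in_fields:
  "smooth_map A U b \<Longrightarrow> (\<lambda>q\<in>U. vector_mv (b q)) \<in> multivector_fields A U"
  using smooth_map_cong[of "\<lambda>q\<in>U. vector_mv (b q)" "\<lambda>q. vector_mv (b q)"]
    smooth_map_linear[OF bounded_linear_vector_mv, of b]
  by (simp add: smooth_fields_def)

text \<open>Grade 1 is preserved, so \<open>vector_part\<close> in \<open>cov_pp\<close> recovers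
  the whole derivative.\<close>

lemma cov_plus_vector:
  assumes "smooth_map A U b" "p \<in> U"
  shows "cov_plus A (U\<^sub>o, \<phi>) U \<gamma> a (\<lambda>q\<in>U. vector_mv (b q)) p =
    vector_mv (dd a b p + blinfun_apply (blinfun_apply (\<gamma> p) a) (b p))"
proof -
  have "dd a (\<lambda>q\<in>U. vector_mv (b q)) p = vector_mv (dd a b p)"
    using dir_deriv_cong[of "\<lambda>q\<in>U. vector_mv (b q)" "\<lambda>q. vector_mv (b q)"]
      dir_deriv_linear[OF bounded_linear_vector_mv assms] assms
      smooth_map_linear[OF bounded_linear_vector_mv, of b] by simp
  then show ?thesis
    using assms by (simp add: cov_plus_apply vector_mv_in_fields derivation_ext_vector[OF linear_blinfun] vector_mv_simps)
qed

text \<open>With \<open>b = h b'\<close>, compatibility of \<open>D\<close> at \<open>b'\<close> is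
  carried by \<open>h_star\<close> to compatibility of \<open>E\<close> at \<open>b\<close>, since
  \<open>h_star\<close> after \<open>g\<close> equals \<open>g'\<close> after
  \<open>h\<close>.\<close>

lemma compatible_gauge_related:
  fixes g g' :: "('m, 'n) extensor_field"
  assumes g: "smooth_map A U g"
    and g': "\<And>p v. p \<in> U \<Longrightarrow>
      blinfun_apply (g p) v = adjoint (blinfun_apply (h p)) (blinfun_apply (g' p) (blinfun_apply (h p) v))"
    and D: "compatible_pair A (U\<^sub>o, \<phi>) U g D"
    and E: "cov_deriv_pair A (U\<^sub>o, \<phi>) U E"
    and rel: "gauge_related A U h D E"
  shows "compatible_pair A (U\<^sub>o, \<phi>) U g' E"
  unfolding compatible_pair_def
proof (intro conjI E allI ballI)
  fix a b p assume b: "b \<in> vector_fields A U" and p: "p \<in> U"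
  define b' where "b' = (\<lambda>q\<in>U. blinfun_apply (k q) (b q))"
  have "smooth_map A U (\<lambda>q. blinfun_apply (k q) (b q))"
    using b by (intro smooth_map_bilinear[OF bounded_bilinear_blinfun_apply] smooth_k) (simp add: smooth_fields_def)
  then have b': "b' \<in> vector_fields A U"
    using smooth_map_cong[of b' "\<lambda>q. blinfun_apply (k q) (b q)"] by (simp add: b'_def smooth_fields_def)
  then have smooth_b': "smooth_map A U b'" by (simp add: smooth_fields_def)
  have hb': "blinfun_apply (h q) (b' q) = b q" if "q \<in> U" for q using that by (simp add: b'_def hk)
  have g'b: "blinfun_apply (g' q) (b q) = blinfun_apply (h_star q) (blinfun_apply (g q) (b' q))" if "q \<in> U" for q
    using that by (simp add: g' hb' h_star_apply star_inverse)
  let ?X = "\<lambda>q\<in>U. vector_mv (b' q)" and ?Y = "\<lambda>q\<in>U. vector_mv (blinfun_apply (g q) (b' q))"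
  have X: "?X \<in> multivector_fields A U" and Y: "?Y \<in> multivector_fields A U"
    by (intro vector_mv_in_fields smooth_b' smooth_map_bilinear[OF bounded_bilinear_blinfun_apply] g)+
  have hX: "(\<lambda>q\<in>U. vector_mv (b q)) = outer_ext U h ?X"
    by (auto simp: outer_ext_def fun_eq_iff outermorphism_vector[OF linear_blinfun] hb')
  have hY: "(\<lambda>q\<in>U. vector_mv (blinfun_apply (g' q) (b q))) = outer_ext_star U h ?Y"
    unfolding outer_ext_star_eq
    by (auto simp: outer_ext_def fun_eq_iff outermorphism_vector[OF linear_blinfun] g'b)
  obtain \<gamma> where \<gamma>: "D = (cov_plus A (U\<^sub>o, \<phi>) U \<gamma>, cov_minus A (U\<^sub>o, \<phi>) U \<gamma>)"
    using D by (auto simp: compatible_pair_def cov_deriv_pair_def)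
  \<comment> \<open>The vector at \<open>p\<close> that represents the plus derivative of
    \<open>b'\<close>; both sides of the compatibility condition are expressed through it.\<close>
  define w where "w = dd a b' p + blinfun_apply (blinfun_apply (\<gamma> p) a) (b' p)"
  have plus: "fst D a ?X p = vector_mv w"
    unfolding w_def \<gamma> fst_conv by (rule cov_plus_vector[OF smooth_b' p])
  have "cov_pp U D a g b' p = 0" using D b' p by (simp add: compatible_pair_def)
  then have minus: "snd D a ?Y p = vector_mv (blinfun_apply (g p) w)"
    using p by (simp add: cov_pp_def plus)
  have "snd E a (outer_ext_star U h ?Y) = outer_ext U h_star (snd D a ?Y)"
    and "fst E a (outer_ext U h ?X) = outer_ext U h (fst D a ?X)"
    using rel X Y unfolding gauge_related_def outer_ext_star_eq by auto
  then have "snd E a (outer_ext_star U h ?Y) p =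
      vector_mv (blinfun_apply (h_star p) (blinfun_apply (g p) w))"
    and "fst E a (outer_ext U h ?X) p = vector_mv (blinfun_apply (h p) w)"
    using p by (simp_all add: outer_ext_def plus minus outermorphism_vector[OF linear_blinfun])
  then show "cov_pp U E a g' b p = 0"
    unfolding cov_pp_def hX hY
    using p by (simp add: g' h_star_apply star_inverse)
qed

text \<open>Serves both halves of the theorem: with \<open>h\<close>, \<open>g\<close>, \<eta> for
  the first and with \<open>k\<close>, \<eta>, \<open>g\<close> for the second. Existence comes from
  \<open>gauge_connection\<close>, uniqueness from surjectivity on fields.\<close>

lemma compatible_transfer:
  fixes g g' :: "('m, 'n) extensor_field"
  assumes g: "smooth_map A U g"
    and g': "\<And>p v. p \<in> U \<Longrightarrow>
      blinfun_apply (g p) v = adjoint (blinfun_apply (h p)) (blinfun_apply (g' p) (blinfun_apply (h p) v))"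
    and D: "compatible_pair A (U\<^sub>o, \<phi>) U g D"
  shows "\<exists>!E. compatible_pair A (U\<^sub>o, \<phi>) U g' E \<and> gauge_related A U h D E"
proof -
  obtain \<gamma> where "smooth_map A U \<gamma>" and \<gamma>: "D = (cov_plus A (U\<^sub>o, \<phi>) U \<gamma>, cov_minus A (U\<^sub>o, \<phi>) U \<gamma>)"
    using D by (auto simp: compatible_pair_def cov_deriv_pair_def)
  then have E: "cov_deriv_pair A (U\<^sub>o, \<phi>) U
      (cov_plus A (U\<^sub>o, \<phi>) U (gauge_connection \<gamma>), cov_minus A (U\<^sub>o, \<phi>) U (gauge_connection \<gamma>))"
    using smooth_gauge_connection by (auto simp: cov_deriv_pair_def)
  show ?thesis
    using compatible_gauge_related[OF g g' D E] gauge_related_connection[of \<gamma>] gauge_related_unique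
    unfolding \<gamma> compatible_pair_def by metis
qed

end

section \<open>The correspondence of compatible pairs in both directions\<close>

theorem theorem2:
  fixes A :: "('m::{t2_space,second_countable_topology}, 'n::{finite,linorder}) chart set"
    and U\<^sub>o U :: "'m set"
    and \<phi>\<^sub>o :: "'m \<Rightarrow> 'n canonical"
    and g \<eta> h :: "('m, 'n) extensor_field"
  assumes "smooth_atlas A"
    and "(U\<^sub>o, \<phi>\<^sub>o) \<in> A"
    and "open U" and "U \<subseteq> U\<^sub>o"
    and "metric_field A U g"
    and "gauge_metric_field A U g \<eta> h"
  shows "(\<forall>D. compatible_pair A (U\<^sub>o, \<phi>\<^sub>o) U g D \<longrightarrow>
            (\<exists>!E. compatible_pair A (U\<^sub>o, \<phi>\<^sub>o) U \<eta> E \<and>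
               (\<forall>a. \<forall>X\<in>multivector_fields A U.
                  outer_ext U h (fst D a X) = fst E a (outer_ext U h X) \<and>
                  outer_ext_star U h (snd D a X) = snd E a (outer_ext_star U h X)))) \<and>
         (\<forall>E. compatible_pair A (U\<^sub>o, \<phi>\<^sub>o) U \<eta> E \<longrightarrow>
            (\<exists>!D. compatible_pair A (U\<^sub>o, \<phi>\<^sub>o) U g D \<and>
               (\<forall>a. \<forall>X\<in>multivector_fields A U.
                  outer_ext U h (fst D a X) = fst E a (outer_ext U h X) \<and>
                  outer_ext_star U h (snd D a X) = snd E a (outer_ext_star U h X))))"
proof -
  interpret c: chart_domain A U\<^sub>o U \<phi>\<^sub>o
    using assms by unfold_locales
  have h: "smooth_map A U h" "\<And>p. p \<in> U \<Longrightarrow> det (matrix (blinfun_apply (h p))) \<noteq> 0"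
    and \<eta>: "smooth_map A U \<eta>" and g: "smooth_map A U g"
    and g_eq: "\<And>p v. p \<in> U \<Longrightarrow> blinfun_apply (g p) v =
        adjoint (blinfun_apply (h p)) (blinfun_apply (\<eta> p) (blinfun_apply (h p) v))"
    using assms(5,6)
    by (auto simp: gauge_metric_field_def metric_field_def pseudo_orthogonal_metric_field_def)
  obtain k where k: "smooth_map A U k"
    "\<And>p v. p \<in> U \<Longrightarrow> blinfun_apply (h p) (blinfun_apply (k p) v) = v"
    "\<And>p v. p \<in> U \<Longrightarrow> blinfun_apply (k p) (blinfun_apply (h p) v) = v"
    by (rule c.smooth_map_inv[OF h]) blast+
  interpret G: gauge A U\<^sub>o U \<phi>\<^sub>o h k
    by unfold_locales (use h k in auto)
  interpret K: gauge A U\<^sub>o U \<phi>\<^sub>o k h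
    by (rule G.gauge_sym)
  \<comment> \<open>Solving \<open>g_eq\<close> for \<eta> gives the same shape with
    \<open>h\<close> and \<open>k\<close> exchanged, as \<open>K.compatible_transfer\<close>
    requires.\<close>
  have \<eta>_eq: "blinfun_apply (\<eta> p) v = adjoint (blinfun_apply (k p)) (blinfun_apply (g p) (blinfun_apply (k p) v))"
    if "p \<in> U" for p v
    using that by (simp add: g_eq k(2) G.star_inverse)
  have rel: "gauge_related A U k E D \<longleftrightarrow> gauge_related A U h D E"
    if "compatible_pair A (U\<^sub>o, \<phi>\<^sub>o) U g D" "compatible_pair A (U\<^sub>o, \<phi>\<^sub>o) U \<eta> E" for D E
    using G.gauge_related_inverse K.gauge_related_inverse that unfolding compatible_pair_def by blast
  \<comment> \<open>The transfer along \<open>k\<close> yields a unique \<open>D\<close> related to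
    \<open>E\<close> by \<open>k\<close>; \<open>rel\<close> turns this into the relation by
    \<open>h\<close> from \<open>D\<close> to \<open>E\<close>.\<close>
  have "\<exists>!D. compatible_pair A (U\<^sub>o, \<phi>\<^sub>o) U g D \<and> gauge_related A U h D E"
    if E: "compatible_pair A (U\<^sub>o, \<phi>\<^sub>o) U \<eta> E" for E
    using K.compatible_transfer[OF \<eta> \<eta>_eq E] rel[OF _ E] by metis
  with G.compatible_transfer[OF g g_eq] show ?thesis
    unfolding gauge_related_def by blast
qed

end
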